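(* Let $\Omega$ and $\Omega'$ be aperiodic repetitive tiling spaces of $\mathbb{R}^d$ with finite local complexity, and let $h:\Omega\to\Omega'$ be a homeomorphism. Then there exist a canonical transversal $\Xi\subset\Omega$, a canonical transversal $\Xi'\subset\Omega'$ and four constants $c,C,m,M>0$ such that for all $r$ big enough, $$c\,\mathcal{R}_{\Xi'}(mr)\le \mathcal{R}_{\Xi}(r)\le C\,\mathcal{R}_{\Xi'}(Mr).$$
   Context: Tilings. A tile is a compact subset of $\mathbb{R}^d$ homeomorphic to a closed ball and equal to the closure of its interior (possibly decorated with a label); a prototile is an equivalence class of tiles under translation. For each tiling space a finite collection of prototiles is fixed. A tiling is a collection $T=\{t_i\}_{i\in I}$ of tiles whose translation classes are in this collection, whose union is $\mathbb{R}^d$, and such that $t_i\cap t_j$ has empty interior for $i\neq j$. For $x\in\mathbb{R}^d$, $T-x=\{t_i-x\}_{i\in I}$ (tilings are not identified with their translates). $B(x,r)$ is the ball of centre $x$ and radius $r$, and $T\cap B(x,r)$ denotes the patch of all tiles of $T$ which intersect $B(x,r)$. $T$ is aperiodic if $T-x\neq T$ for all $x\neq 0$; $T$ has finite local complexity (FLC) if for all $R>0$ there are finitely many patches $T\cap B(x,R)$, $x\in\mathbb{R}^d$, up to translation; $T$ is repetitive if for every finite patch $P\subset T$ there is $R>0$ such that a translate of $P$ appears in $T\cap B(x,R)$ for every $x\in\mathbb{R}^d$. Tiling spaces. Define a distance on tilings with the given prototiles by letting $D(T_1,T_2)$ be the minimum of $1/\sqrt2$ and the infimum of all $\varepsilon>0$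 for which there are $x_1,x_2\in\mathbb{R}^d$ with $\|x_i\|\le\varepsilon$ such that $T_1-x_1$ and $T_2-x_2$ agree on $B(0,1/\varepsilon)$. The hull (tiling space) of $T$ is the closure $\Omega=\overline{\{T-x : x\in\mathbb{R}^d\}}$ for $D$; $\mathbb{R}^d$ acts continuously on it by translation. An aperiodic repetitive tiling space with FLC is the hull of an aperiodic, repetitive tiling with FLC. Transversals. A Delaunay set is a uniformly discrete and relatively dense subset of $\mathbb{R}^d$. A local pointing rule on $\Omega$ is a map $\mathcal{D}$ assigning to each $T\in\Omega$ a Delaunay set $\mathcal{D}(T)$, commuting with translations ($\mathcal{D}(T-x)=\mathcal{D}(T)-x$), and local: there are $\rho,R>0$ such that for all $T\in\Omega$, $\mathcal{D}(T)\cap B(0,\rho)$ only depends on $T\cap B(0,R)$. The canonical transversal associated with $\mathcal{D}$ is $\Xi_{\mathcal{D}}=\{T\in\Omega : 0\in\mathcal{D}(T)\}$. Repetitivity. For a canonical transversal $\Xi$, the repetitivity function is $$\mathcal{R}_\Xi(r)=\inf\{R>0 : \forall\, T,T_0\in\Xi,\ \exists\, x\in B(0,R),\ (T-x)\cap B(0,r)=T_0\cap B(0,r)\}.$$ *)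

theory Defs
  imports "HOL-Analysis.Analysis"
begin

(* A tile is a support together with a label; unlabelled tiles are the case of label type unit.
   A set of tiles serves as a patch or as a tiling. *)
type_synonym ('n, 'l) tile = "(real^'n) set \<times> 'l"
type_synonym ('n, 'l) tiling = "('n, 'l) tile set"

definition is_tile :: "('n::finite, 'l) tile \<Rightarrow> bool" where
  "is_tile t \<longleftrightarrow> compact (fst t) \<and> fst t homeomorphic cball (0 :: real^'n) 1 \<and>
     closure (interior (fst t)) = fst t"

(* Translation by -x, as in t - x and T - x. *)
definition translate_tile :: "real^'n \<Rightarrow> ('n::finite, 'l) tile \<Rightarrow> ('n, 'l) tile" where
  "translate_tile x t = ((\<lambda>y. y - x) ` fst t, snd t)"

definition translate :: "real^'n \<Rightarrow> ('n::finite, 'l) tiling \<Rightarrow> ('n, 'l) tiling" where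
  "translate x T = translate_tile x ` T"

definition prototiles :: "('n::finite, 'l) tile set set" where
  "prototiles = {t. is_tile t} // {(s, t). \<exists>x. t = translate_tile x s}"

(* The tilings of R^d whose tiles belong to the translation classes in \<P>.  Since distinct
   elements of T may differ in their labels only, the last clause also excludes that a support
   occurs with two labels. *)
definition tilings :: "('n::finite, 'l) tile set set \<Rightarrow> ('n, 'l) tiling set" where
  "tilings \<P> = {T. T \<subseteq> \<Union>\<P> \<and> (\<Union>t\<in>T. fst t) = UNIV \<and>
     (\<forall>s\<in>T. \<forall>t\<in>T. s \<noteq> t \<longrightarrow> interior (fst s \<inter> fst t) = {})}"

(* The patch usually written as the intersection of T with B(x,r). *)
definition patch :: "('n::finite, 'l) tiling \<Rightarrow> real^'n \<Rightarrow> real \<Rightarrow> ('n, 'l) tiling" where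
  "patch T x r = {t \<in> T. fst t \<inter> ball x r \<noteq> {}}"

definition aperiodic :: "('n::finite, 'l) tiling \<Rightarrow> bool" where
  "aperiodic T \<longleftrightarrow> (\<forall>x. x \<noteq> 0 \<longrightarrow> translate x T \<noteq> T)"

definition finite_local_complexity :: "('n::finite, 'l) tiling \<Rightarrow> bool" where
  "finite_local_complexity T \<longleftrightarrow>
     (\<forall>R>0. finite (range (\<lambda>x. patch T x R) // {(P, Q). \<exists>v. Q = translate v P}))"

definition repetitive :: "('n::finite, 'l) tiling \<Rightarrow> bool" where
  "repetitive T \<longleftrightarrow>
     (\<forall>P. finite P \<and> P \<subseteq> T \<longrightarrow> (\<exists>R>0. \<forall>x. \<exists>v. translate v P \<subseteq> patch T x R))"

(* Taking the infimum after inserting 1 / sqrt 2 yields the minimum of 1 / sqrt 2 and the infimum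
   of the set on the right, also when that set is empty (infimum +\<infinity>). *)
definition tiling_dist :: "('n::finite, 'l) tiling \<Rightarrow> ('n, 'l) tiling \<Rightarrow> real" where
  "tiling_dist T1 T2 = Inf (insert (1 / sqrt 2)
     {\<epsilon>. \<epsilon> > 0 \<and> (\<exists>x1 x2. norm x1 \<le> \<epsilon> \<and> norm x2 \<le> \<epsilon> \<and>
        patch (translate x1 T1) 0 (1 / \<epsilon>) = patch (translate x2 T2) 0 (1 / \<epsilon>))})"

definition tilings_topology :: "('n::finite, 'l) tile set set \<Rightarrow> ('n, 'l) tiling topology" where
  "tilings_topology \<P> = Metric_space.mtopology (tilings \<P>) tiling_dist"

definition tiling_hull :: "('n::finite, 'l) tile set set \<Rightarrow> ('n, 'l) tiling \<Rightarrow> ('n, 'l) tiling set" where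
  "tiling_hull \<P> T = tilings_topology \<P> closure_of (range (\<lambda>x. translate x T))"

definition aperiodic_repetitive_FLC_space ::
    "('n::finite, 'l) tile set set \<Rightarrow> ('n, 'l) tiling set \<Rightarrow> bool" where
  "aperiodic_repetitive_FLC_space \<P> \<Omega> \<longleftrightarrow> finite \<P> \<and> \<P> \<subseteq> prototiles \<and>
     (\<exists>T \<in> tilings \<P>. aperiodic T \<and> repetitive T \<and> finite_local_complexity T \<and> \<Omega> = tiling_hull \<P> T)"

definition delaunay :: "(real^'n::finite) set \<Rightarrow> bool" where
  "delaunay S \<longleftrightarrow> uniform_discrete S \<and> (\<exists>R>0. \<forall>x. S \<inter> ball x R \<noteq> {})"

definition local_pointing_rule ::
    "('n::finite, 'l) tiling set \<Rightarrow> (('n, 'l) tiling \<Rightarrow> (real^'n) set) \<Rightarrow> bool" where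
  "local_pointing_rule \<Omega> \<D> \<longleftrightarrow>
     (\<forall>T\<in>\<Omega>. delaunay (\<D> T)) \<and>
     (\<forall>T\<in>\<Omega>. \<forall>x. \<D> (translate x T) = (\<lambda>y. y - x) ` \<D> T) \<and>
     (\<exists>\<rho>>0. \<exists>R>0. \<forall>T1\<in>\<Omega>. \<forall>T2\<in>\<Omega>. patch T1 0 R = patch T2 0 R \<longrightarrow>
        \<D> T1 \<inter> ball 0 \<rho> = \<D> T2 \<inter> ball 0 \<rho>)"

definition canonical_transversal ::
    "('n::finite, 'l) tiling set \<Rightarrow> ('n, 'l) tiling set \<Rightarrow> bool" where
  "canonical_transversal \<Omega> \<Xi> \<longleftrightarrow>
     (\<exists>\<D>. local_pointing_rule \<Omega> \<D> \<and> \<Xi> = {T \<in> \<Omega>. 0 \<in> \<D> T})"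

(* For a canonical transversal of a repetitive space with finite local complexity the set below
   is nonempty, so that the real-valued infimum is the intended one. *)
definition repetitivity :: "('n::finite, 'l) tiling set \<Rightarrow> real \<Rightarrow> real" where
  "repetitivity \<Xi> r =
     Inf {R. R > 0 \<and> (\<forall>T\<in>\<Xi>. \<forall>T0\<in>\<Xi>. \<exists>x\<in>ball 0 R. patch (translate x T) 0 r = patch T0 0 r)}"

end

theory Submission
  imports Defs
begin

text \<open>
  Let \<open>g\<close> be the inverse of \<open>h\<close>.  By symmetry it suffices to bound the repetitivity function of the
  source by that of the target; the lower bound is the same estimate for \<open>g\<close>.  Two facts are needed.

  First, translations lift with linear control: \<open>h (T - x) = h T - y\<close> with \<open>norm y \<le> C * norm x + C\<close>
  (\<open>translation_lift\<close>).  Second, if \<open>h S\<close> and \<open>h S0\<close> agree on the ball of radius \<open>M * r + M\<close>, then \<open>S\<close>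
  and \<open>S0\<close> agree on the ball of radius \<open>r\<close> after one translation of length at most \<open>1\<close>
  (\<open>agree_transfer\<close>).  Granted these, a return of a large patch in the target is pulled back to a return
  of a proportionally large patch in the source, at a proportional distance
  (\<open>repetitivity_transfer\<close>).

  Both facts come from uniform continuity and rigidity.  The hull is compact
  (\<open>compactin_hull\<close>), so \<open>h\<close> and \<open>g\<close> are uniformly continuous: closeness means agreement on a large
  ball up to a small translation.  Rigidity (\<open>rigid\<close>) says that a tiling cannot agree around a point with
  a translate of itself by a short nonzero vector, because a tile would overlap its own copy.  Hence a
  small translation that realises closeness is unique.  Moving along a segment in small steps, it
  cannot drift: this turns approximate into exact statements, once for the lifting of small
  translations (\<open>agree_along_segment\<close>) and once for the transfer of agreement.  In effect this is a
  discrete substitute for the argument that \<open>h\<close> maps path components, which are the orbits, to path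
  components, the transversals being totally disconnected.

  Finite local complexity and repetitivity of the generating tiling give compactness and a return
  radius that is uniform over the hull (\<open>uniformly_repetitive\<close>), so that the repetitivity function
  is finite.  Aperiodicity keeps it away from zero (\<open>repetitivity_transversal_ge\<close>), so that additive
  constants can be absorbed into multiplicative ones.
\<close>

section \<open>Patches and agreement near the origin\<close>

lemma fst_translate_tile: "fst (translate_tile x t) = (\<lambda>y. y - x) ` fst t"
  by (simp add: translate_tile_def)

lemma translate_tile_0 [simp]: "translate_tile 0 t = t"
  by (simp add: translate_tile_def)

lemma translate_tile_add [simp]: "translate_tile x (translate_tile y t) = translate_tile (x + y) t"
  by (simp add: translate_tile_def image_image algebra_simps)

lemma translate_0 [simp]: "translate 0 T = T"
  by (simp add: translate_def)

lemma translate_add [simp]: "translate x (translate y T) = translate (x + y) T"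
  by (simp add: translate_def image_image)

lemma mem_translate: "t \<in> translate x T \<longleftrightarrow> translate_tile (- x) t \<in> T"
proof
  assume "t \<in> translate x T"
  then show "translate_tile (- x) t \<in> T"
    by (auto simp: translate_def)
next
  assume "translate_tile (- x) t \<in> T"
  then show "t \<in> translate x T"
    unfolding translate_def by (rule rev_image_eqI) simp
qed

lemma in_fst_translate_tile: "y \<in> fst (translate_tile x t) \<longleftrightarrow> y + x \<in> fst t"
  by (force simp: fst_translate_tile image_iff algebra_simps)

lemma mem_patch: "t \<in> patch T x r \<longleftrightarrow> t \<in> T \<and> (\<exists>y. y \<in> fst t \<and> dist x y < r)"
  by (auto simp: patch_def)

lemma patch_translate:
  fixes T :: "('n::finite, 'l) tiling"
  shows "patch (translate v T) x r = translate v (patch T (x + v) r)"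
proof (rule set_eqI)
  fix t :: "('n, 'l) tile"
  have "(\<exists>y. y \<in> fst t \<and> dist x y < r) \<longleftrightarrow>
        (\<exists>y. y \<in> fst (translate_tile (- v) t) \<and> dist (x + v) y < r)" (is "?L \<longleftrightarrow> ?R")
  proof
    assume ?L
    then obtain y where "y \<in> fst t" "dist x y < r" by auto
    then show ?R
      by (intro exI[of _ "y + v"]) (auto simp: in_fst_translate_tile)
  next
    assume ?R
    then obtain y where "y - v \<in> fst t" "dist (x + v) y < r"
      by (auto simp: in_fst_translate_tile)
    then show ?L
      by (intro exI[of _ "y - v"]) (auto simp: dist_norm algebra_simps)
  qed
  then show "t \<in> patch (translate v T) x r \<longleftrightarrow> t \<in> translate v (patch T (x + v) r)"
    by (simp add: mem_patch mem_translate)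
qed

lemma patch_subset: "patch T x r \<subseteq> T"
  by (auto simp: patch_def)

lemma patch_eq_on_ball:
  assumes "patch S a r = patch T b s" "ball c q \<subseteq> ball a r" "ball c q \<subseteq> ball b s"
  shows "patch S c q = patch T c q"
proof -
  have "patch S c q = {t \<in> patch S a r. fst t \<inter> ball c q \<noteq> {}}"
    using assms(2) by (fastforce simp: patch_def)
  also have "\<dots> = {t \<in> patch T b s. fst t \<inter> ball c q \<noteq> {}}"
    by (simp add: assms(1))
  also have "\<dots> = patch T c q"
    using assms(3) by (fastforce simp: patch_def)
  finally show ?thesis .
qed

definition agree :: "real \<Rightarrow> ('n::finite, 'l) tiling \<Rightarrow> ('n, 'l) tiling \<Rightarrow> bool" where
  "agree r S T \<longleftrightarrow> patch S 0 r = patch T 0 r"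

lemma agree_refl [simp]: "agree r S S"
  by (simp add: agree_def)

lemma agree_sym: "agree r S T \<Longrightarrow> agree r T S"
  by (simp add: agree_def)

lemma agree_trans: "agree r S T \<Longrightarrow> agree r T U \<Longrightarrow> agree r S U"
  by (simp add: agree_def)

lemma agree_mono: "agree r S T \<Longrightarrow> s \<le> r \<Longrightarrow> agree s S T"
  unfolding agree_def by (erule patch_eq_on_ball) auto

lemma agree_translate:
  assumes "agree r S T" "s + norm v \<le> r"
  shows "agree s (translate v S) (translate v T)"
proof -
  have "ball v s \<subseteq> ball 0 r"
    using assms(2) by (intro ball_subset_ball_iff[THEN iffD2]) (auto simp: dist_norm)
  then have "patch S v s = patch T v s"
    using assms(1) unfolding agree_def by (metis patch_eq_on_ball)
  then show ?thesis
    by (simp add: agree_def patch_translate)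
qed

text \<open>Agreement on a large ball is a local condition.  This is what lets agreement be spread along
  a path of centres.\<close>

lemma agree_if_locally_agree:
  assumes "\<And>x. norm x < r \<Longrightarrow> agree k (translate x S) (translate x T)" "k > 0"
  shows "agree r S T"
proof -
  have *: "patch S x k = patch T x k" if "norm x < r" for x
  proof -
    have "translate x (patch S x k) = translate x (patch T x k)"
      using assms(1)[OF that] by (simp add: agree_def patch_translate)
    then have "translate (- x) (translate x (patch S x k)) =
      translate (- x) (translate x (patch T x k))"
      by simp
    then show ?thesis by simp
  qed
  have "t \<in> patch S 0 r \<longleftrightarrow> t \<in> patch T 0 r" for t
  proof -
    have "t \<in> patch S 0 r \<longleftrightarrow> (\<exists>y. norm y < r \<and> y \<in> fst t \<and> t \<in> patch S y k)" for S
      using \<open>k > 0\<close> by (force simp: mem_patch)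
    then show ?thesis using * by blast
  qed
  then show ?thesis unfolding agree_def by blast
qed

text \<open>Agreement on arbitrarily large balls forces equality because each tile meets one of these
  balls; the empty set as a support would escape.\<close>

lemma eq_if_agree:
  assumes "\<And>r. r > 0 \<Longrightarrow> \<exists>s\<ge>r. agree s S T"
    and "\<And>t. t \<in> S \<Longrightarrow> fst t \<noteq> {}" "\<And>t. t \<in> T \<Longrightarrow> fst t \<noteq> {}"
  shows "S = T"
proof -
  have *: "U \<subseteq> V" if "\<And>r. r > 0 \<Longrightarrow> agree r U V" "\<And>t. t \<in> U \<Longrightarrow> fst t \<noteq> {}"
    for U V :: "('a, 'b) tiling"
  proof
    fix t assume "t \<in> U"
    with that(2) obtain y where y: "y \<in> fst t" by blast
    have "agree (norm y + 1) U V"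
      by (rule that(1)) (simp add: add_nonneg_pos)
    moreover have "t \<in> patch U 0 (norm y + 1)"
      using y \<open>t \<in> U\<close> by (auto simp: mem_patch intro!: exI[of _ y])
    ultimately show "t \<in> V"
      using patch_subset unfolding agree_def by blast
  qed
  have "agree r S T" if "r > 0" for r
    using assms(1)[OF that] agree_mono by blast
  then have "S \<subseteq> T" "T \<subseteq> S"
    by (intro *; use assms(2,3) agree_sym in blast)+
  then show ?thesis by blast
qed

text \<open>The asymmetric form of being at distance at most \<open>e\<close>, with a single shift.  For small
  \<open>e\<close> it is comparable with the tiling metric up to a factor of two, and it is easier to compose.\<close>

definition near :: "real \<Rightarrow> ('n::finite, 'l) tiling \<Rightarrow> ('n, 'l) tiling \<Rightarrow> bool" where
  "near e S T \<longleftrightarrow> (\<exists>u. norm u \<le> e \<and> agree (1 / e) S (translate u T))"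

lemma near_mono:
  assumes "near d S T" "0 < d" "d \<le> e"
  shows "near e S T"
proof -
  have "1 / e \<le> 1 / d" using assms by (simp add: frac_le)
  then show ?thesis using assms unfolding near_def by (metis agree_mono order_trans)
qed

lemma near_refl: "e > 0 \<Longrightarrow> near e S S"
  unfolding near_def by (rule exI[of _ 0]) simp

section \<open>Tilings by finitely many prototiles\<close>

text \<open>What a finite supply of prototiles means geometrically: the tiles contain balls of a common
  radius \<open>\<rho>\<close>, and their diameters have a common bound \<open>D\<close>.\<close>

locale fat_tiles =
  fixes \<P> :: "('n::finite, 'l) tile set set" and \<rho> D :: real
  assumes rho_pos: "\<rho> > 0" and D_pos: "D > 0"
    and compact_tile: "\<And>t. t \<in> \<Union>\<P> \<Longrightarrow> compact (fst t)"
    and regular_tile: "\<And>t. t \<in> \<Union>\<P> \<Longrightarrow> closure (interior (fst t)) = fst t"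
    and inner_ball: "\<And>t. t \<in> \<Union>\<P> \<Longrightarrow> \<exists>c. ball c \<rho> \<subseteq> fst t"
    and diam_tile: "\<And>t x y. t \<in> \<Union>\<P> \<Longrightarrow> x \<in> fst t \<Longrightarrow> y \<in> fst t \<Longrightarrow> dist x y \<le> D"
    and translate_tile_in: "\<And>t x. t \<in> \<Union>\<P> \<Longrightarrow> translate_tile x t \<in> \<Union>\<P>"

lemma is_tile_ball: "is_tile t \<Longrightarrow> \<exists>r>0. \<exists>c. ball c r \<subseteq> fst t"
proof -
  assume t: "is_tile t"
  have "fst t \<noteq> {}"
    using t homeomorphic_empty unfolding is_tile_def by fastforce
  then have "interior (fst t) \<noteq> {}"
    using t unfolding is_tile_def by (metis closure_empty)
  then obtain x where "x \<in> interior (fst t)" by blast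
  then show ?thesis unfolding mem_interior by blast
qed

lemma is_tile_translate: "is_tile t \<Longrightarrow> is_tile (translate_tile x t)"
proof -
  assume t: "is_tile t"
  have eq: "fst (translate_tile x t) = (\<lambda>y. - x + y) ` fst t"
    by (simp add: fst_translate_tile)
  have "(\<lambda>y. - x + y) ` fst t homeomorphic fst t"
    using homeomorphic_translation homeomorphic_sym by blast
  then have "(\<lambda>y. - x + y) ` fst t homeomorphic cball (0 :: real^'a) 1"
    using t homeomorphic_trans unfolding is_tile_def by blast
  moreover have "compact ((\<lambda>y. - x + y) ` fst t)"
    using t unfolding is_tile_def by (metis compact_translation)
  moreover have "closure (interior ((\<lambda>y. - x + y) ` fst t)) = (\<lambda>y. - x + y) ` fst t"
    using t unfolding is_tile_def by (simp only: interior_translation closure_translation)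
  ultimately show ?thesis
    unfolding is_tile_def eq by blast
qed

lemma finite_prototiles_fat:
  assumes "finite \<P>" "\<P> \<subseteq> prototiles"
  shows "\<exists>\<rho> D. fat_tiles \<P> \<rho> D"
proof -
  have "\<exists>r>0. \<exists>D>0. \<forall>t\<in>p. (\<exists>c. ball c r \<subseteq> fst t) \<and> (\<forall>x\<in>fst t. \<forall>y\<in>fst t. dist x y \<le> D) \<and> is_tile t \<and>
     (\<forall>x. translate_tile x t \<in> p)" if "p \<in> \<P>" for p
  proof -
    have "p \<in> prototiles" using \<open>p \<in> \<P>\<close> assms(2) by blast
    then obtain t0 where "t0 \<in> {t. is_tile t}" "p = {(s, t). \<exists>x. t = translate_tile x s} `` {t0}"
      unfolding prototiles_def by (rule quotientE)
    then have t0: "is_tile t0" "p = range (\<lambda>x. translate_tile x t0)"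
      by auto
    obtain r c where r: "r > 0" "ball c r \<subseteq> fst t0" using is_tile_ball[OF t0(1)] by blast
    have "bounded (fst t0)" using t0 by (simp add: is_tile_def compact_imp_bounded)
    then obtain D where D: "\<And>x y. x \<in> fst t0 \<Longrightarrow> y \<in> fst t0 \<Longrightarrow> dist x y \<le> D"
      by (meson bounded_two_points)
    have "(\<exists>c. ball c r \<subseteq> fst t) \<and> (\<forall>x\<in>fst t. \<forall>y\<in>fst t. dist x y \<le> max D 1) \<and> is_tile t \<and>
      (\<forall>x. translate_tile x t \<in> p)" if "t \<in> p" for t
    proof -
      obtain x where t: "t = translate_tile x t0" using \<open>t \<in> p\<close> t0(2) by auto
      have "ball (c - x) r \<subseteq> fst t"
      proof
        fix y assume "y \<in> ball (c - x) r"
        then have "y + x \<in> ball c r" by (simp add: dist_norm algebra_simps)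
        then show "y \<in> fst t" using r by (auto simp: t in_fst_translate_tile)
      qed
      moreover have "dist y z \<le> max D 1" if "y \<in> fst t" "z \<in> fst t" for y z
      proof -
        have "dist (y + x) (z + x) \<le> D"
          using that by (intro D) (auto simp: t in_fst_translate_tile)
        then show ?thesis by simp
      qed
      moreover have "translate_tile y t \<in> p" for y by (simp add: t t0(2))
      ultimately show ?thesis using is_tile_translate t t0(1) by blast
    qed
    moreover have "max D 1 > 0" by simp
    ultimately show ?thesis using \<open>r > 0\<close> by blast
  qed
  then obtain r D where rD: "\<And>p. p \<in> \<P> \<Longrightarrow> r p > 0" "\<And>p. p \<in> \<P> \<Longrightarrow> D p > 0"
    "\<And>p t. p \<in> \<P> \<Longrightarrow> t \<in> p \<Longrightarrow> (\<exists>c. ball c (r p) \<subseteq> fst t) \<and>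
      (\<forall>x\<in>fst t. \<forall>y\<in>fst t. dist x y \<le> D p) \<and> is_tile t \<and> (\<forall>x. translate_tile x t \<in> p)"
    by metis
  define \<rho> where "\<rho> = Min (insert 1 (r ` \<P>))"
  define E where "E = Max (insert 1 (D ` \<P>))"
  have \<rho>: "\<rho> > 0" "\<And>p. p \<in> \<P> \<Longrightarrow> \<rho> \<le> r p"
    using assms(1) rD(1) by (auto simp: \<rho>_def)
  have E: "E \<ge> 1" "\<And>p. p \<in> \<P> \<Longrightarrow> D p \<le> E"
    using assms(1) by (auto simp: E_def)
  have "fat_tiles \<P> \<rho> E"
  proof
    fix t assume "t \<in> \<Union>\<P>"
    then obtain p where p: "p \<in> \<P>" "t \<in> p" by blast
    have "is_tile t" using rD(3)[OF p] by blast
    then show "compact (fst t)" "closure (interior (fst t)) = fst t"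
      by (auto simp: is_tile_def)
    show "\<exists>c. ball c \<rho> \<subseteq> fst t"
      using rD(3)[OF p] \<rho>(2)[OF p(1)] by (meson order_trans subset_ball)
    show "dist x y \<le> E" if "x \<in> fst t" "y \<in> fst t" for x y
      using rD(3)[OF p] E(2)[OF p(1)] that by (meson order_trans)
    show "translate_tile x t \<in> \<Union>\<P>" for x
      using rD(3)[OF p] p(1) by blast
  qed (use \<rho> E in auto)
  then show ?thesis by blast
qed

context fat_tiles
begin

lemma tile_nonempty: "t \<in> \<Union>\<P> \<Longrightarrow> fst t \<noteq> {}"
  using inner_ball[of t] rho_pos by (metis centre_in_ball empty_iff subsetD)

lemma tiling_tile: "T \<in> tilings \<P> \<Longrightarrow> t \<in> T \<Longrightarrow> t \<in> \<Union>\<P>"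
  unfolding tilings_def mem_Collect_eq by (metis subsetD)

lemma tiling_cover: "T \<in> tilings \<P> \<Longrightarrow> \<exists>t\<in>T. x \<in> fst t"
proof -
  assume "T \<in> tilings \<P>"
  then have "x \<in> (\<Union>t\<in>T. fst t)" by (simp add: tilings_def)
  then show ?thesis by simp
qed

lemma tiling_disjoint:
  "T \<in> tilings \<P> \<Longrightarrow> s \<in> T \<Longrightarrow> t \<in> T \<Longrightarrow> interior (fst s \<inter> fst t) \<noteq> {} \<Longrightarrow> s = t"
  unfolding tilings_def mem_Collect_eq by metis

lemma translate_tilings:
  assumes "T \<in> tilings \<P>"
  shows "translate x T \<in> tilings \<P>"
proof -
  have "t \<in> \<Union>\<P>" if "t \<in> translate x T" for t
    using that tiling_tile[OF assms] translate_tile_in unfolding translate_def by blast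
  moreover have "(\<Union>t\<in>translate x T. fst t) = UNIV"
  proof -
    have "\<exists>t\<in>translate x T. y \<in> fst t" for y
      using tiling_cover[OF assms, of "y + x"] by (auto simp: translate_def in_fst_translate_tile)
    then show ?thesis by auto
  qed
  moreover have "s = t" if st: "s \<in> translate x T" "t \<in> translate x T"
    "interior (fst s \<inter> fst t) \<noteq> {}" for s t
  proof -
    obtain s' t' where s': "s' \<in> T" "s = translate_tile x s'" and t': "t' \<in> T" "t = translate_tile x t'"
      using st by (auto simp: translate_def)
    have "fst s \<inter> fst t = (\<lambda>y. - x + y) ` (fst s' \<inter> fst t')"
      by (auto simp: s' t' fst_translate_tile)
    then have "interior (fst s' \<inter> fst t') \<noteq> {}"
      using st(3) by (simp only: interior_translation image_is_empty) simp
    then show "s = t" using tiling_disjoint[OF assms s'(1) t'(1)] s' t' by simp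
  qed
  ultimately show ?thesis unfolding tilings_def by blast
qed

text \<open>A tile shifted by less than the common inner radius overlaps itself, so no tiling can contain
  both copies.\<close>

lemma rigid:
  assumes T: "T \<in> tilings \<P>" and "r > 0" "norm v < \<rho>" and agr: "agree r (translate v T) T"
  shows "v = 0"
proof -
  obtain t where t: "t \<in> T" "0 \<in> fst t" using tiling_cover[OF T] by blast
  then have "t \<in> patch T 0 r" using \<open>r > 0\<close> by (auto simp: mem_patch)
  then have "t \<in> translate v T" using agr patch_subset unfolding agree_def by blast
  then have s: "translate_tile (- v) t \<in> T" by (simp add: mem_translate)
  obtain c where c: "ball c \<rho> \<subseteq> fst t" using inner_ball tiling_tile[OF T t(1)] by blast
  have "ball c \<rho> \<inter> ball (c + v) \<rho> \<subseteq> fst t \<inter> fst (translate_tile (- v) t)"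
  proof
    fix y assume y: "y \<in> ball c \<rho> \<inter> ball (c + v) \<rho>"
    then have "y - v \<in> ball c \<rho>" by (simp add: dist_norm algebra_simps)
    then show "y \<in> fst t \<inter> fst (translate_tile (- v) t)"
      using y c by (auto simp: in_fst_translate_tile)
  qed
  then have "ball c \<rho> \<inter> ball (c + v) \<rho> \<subseteq> interior (fst t \<inter> fst (translate_tile (- v) t))"
    by (intro interior_maximal) auto
  moreover have "c \<in> ball c \<rho> \<inter> ball (c + v) \<rho>"
    using rho_pos \<open>norm v < \<rho>\<close> by (simp add: dist_norm)
  ultimately have "translate_tile (- v) t = t"
    using tiling_disjoint[OF T s t(1)] by (metis Int_commute empty_iff subset_iff)
  then have inv: "y + v \<in> fst t" if "y \<in> fst t" for y
    using that by (metis add.inverse_inverse add_diff_cancel in_fst_translate_tile diff_conv_add_uminus)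
  \<comment> \<open>a bounded tile is not invariant under a nonzero translation\<close>
  have "real k *\<^sub>R v \<in> fst t" for k
  proof (induction k)
    case 0 then show ?case using t by simp
  next
    case (Suc k) then show ?case using inv[OF Suc] by (simp add: algebra_simps)
  qed
  then have le: "real k * norm v \<le> D" for k
    using diam_tile[OF tiling_tile[OF T t(1)], of "real k *\<^sub>R v" 0] t(2) by simp
  show "v = 0"
  proof (rule ccontr)
    assume "v \<noteq> 0"
    then obtain k where "D < real k * norm v" using reals_Archimedean3[of "norm v"] by auto
    then show False using le[of k] by simp
  qed
qed

text \<open>Inner balls of distinct tiles are disjoint, so their centres are uniformly discrete, and
  the centres belonging to one patch are bounded.\<close>

lemma finite_patch:
  assumes T: "T \<in> tilings \<P>"
  shows "finite (patch T x r)"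
proof -
  obtain c where c: "\<And>t. t \<in> T \<Longrightarrow> ball (c t) \<rho> \<subseteq> fst t"
    using inner_ball tiling_tile[OF T] by metis
  have sep: "s = t" if "s \<in> T" "t \<in> T" "dist (c s) (c t) < \<rho>" for s t
  proof (rule tiling_disjoint[OF T that(1,2)])
    have "ball (c s) \<rho> \<inter> ball (c t) \<rho> \<subseteq> interior (fst s \<inter> fst t)"
      using c that by (intro interior_maximal) blast+
    moreover have "c s \<in> ball (c s) \<rho> \<inter> ball (c t) \<rho>"
      using that rho_pos by (simp add: dist_commute)
    ultimately show "interior (fst s \<inter> fst t) \<noteq> {}" by blast
  qed
  have "inj_on c (patch T x r)"
  proof (rule inj_onI)
    show "s = t" if st: "s \<in> patch T x r" "t \<in> patch T x r" "c s = c t" for s t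
      using st sep[of s t] rho_pos patch_subset[of T x r] by auto
  qed
  moreover have "uniform_discrete (c ` patch T x r)"
    unfolding uniform_discrete_def
  proof (intro exI conjI ballI impI)
    show "\<rho> > 0" by (rule rho_pos)
    show "u = v" if uv: "u \<in> c ` patch T x r" "v \<in> c ` patch T x r" "dist u v < \<rho>" for u v
    proof -
      obtain s t where "s \<in> patch T x r" "t \<in> patch T x r" "u = c s" "v = c t"
        using uv by blast
      then show ?thesis using sep[of s t] uv(3) patch_subset[of T x r] by auto
    qed
  qed
  moreover have "bounded (c ` patch T x r)"
  proof -
    have "dist x (c t) \<le> r + D" if t: "t \<in> patch T x r" for t
    proof -
      obtain y where y: "y \<in> fst t" "dist x y < r" and "t \<in> T" using t by (auto simp: mem_patch)
      have "c t \<in> fst t" using c[OF \<open>t \<in> T\<close>] rho_pos by auto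
      then have "dist y (c t) \<le> D" using diam_tile tiling_tile[OF T \<open>t \<in> T\<close>] y by blast
      then show ?thesis using y dist_triangle[of x "c t" y] by linarith
    qed
    then show ?thesis unfolding bounded_def by blast
  qed
  ultimately show ?thesis
    using uniform_discrete_finite_iff finite_imageD by blast
qed

text \<open>A patch covers the ball that it was cut out of.  A tile of another tiling that contains
  the patch and that meets the ball has interior points there, and finitely many closed tiles
  cannot cover these without one of them overlapping it.\<close>

lemma patch_determined:
  assumes S: "S \<in> tilings \<P>" and T: "T \<in> tilings \<P>" and sub: "patch S x r \<subseteq> T"
  shows "patch S x r = patch T x r"
proof
  show "patch S x r \<subseteq> patch T x r" using sub by (auto simp: patch_def)
  show "patch T x r \<subseteq> patch S x r"
  proof
    fix t assume "t \<in> patch T x r"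
    then have t: "t \<in> T" "fst t \<inter> ball x r \<noteq> {}" by (auto simp: patch_def)
    define U where "U = interior (fst t) \<inter> ball x r"
    have "closure (interior (fst t)) \<inter> ball x r \<noteq> {}"
      using t regular_tile tiling_tile[OF T] by metis
    then have "U \<noteq> {}" "open U"
      unfolding U_def by (auto simp: open_Int_closure_eq_empty Int_commute)
    have cov: "U \<subseteq> (\<Union>s\<in>patch S x r. fst s \<inter> fst t)"
    proof
      fix y assume y: "y \<in> U"
      obtain s where "s \<in> S" "y \<in> fst s" using tiling_cover[OF S] by blast
      then show "y \<in> (\<Union>s\<in>patch S x r. fst s \<inter> fst t)"
        using y interior_subset unfolding U_def by (fastforce simp: patch_def)
    qed
    have *: "finite F \<Longrightarrow> (\<And>s. s \<in> F \<Longrightarrow> closed (G s) \<and> interior (G s) = {}) \<Longrightarrow> interior (\<Union>s\<in>F. G s) = {}"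
      for F :: "('n, 'l) tile set" and G :: "('n, 'l) tile \<Rightarrow> (real^'n) set"
    proof (induction F rule: finite_induct)
      case (insert s F)
      have "interior ((G s) \<union> (\<Union>s\<in>F. G s)) = interior (G s)"
        using insert by (intro interior_closed_Un_empty_interior) auto
      then show ?case using insert by simp
    qed simp
    have cl: "closed (fst s)" if "s \<in> \<Union>\<P>" for s using that compact_tile compact_imp_closed by blast
    have "\<exists>s\<in>patch S x r. interior (fst s \<inter> fst t) \<noteq> {}"
    proof (rule ccontr)
      assume "\<not> ?thesis"
      then have "interior (\<Union>s\<in>patch S x r. fst s \<inter> fst t) = {}"
        using patch_subset[of S x r] cl[OF tiling_tile[OF S]] cl[OF tiling_tile[OF T t(1)]]
        by (intro * finite_patch[OF S]) (blast intro: closed_Int)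
      moreover have "U \<subseteq> interior (\<Union>s\<in>patch S x r. fst s \<inter> fst t)"
        using cov \<open>open U\<close> by (rule interior_maximal)
      ultimately show False using \<open>U \<noteq> {}\<close> by simp
    qed
    then obtain s where s: "s \<in> patch S x r" "interior (fst s \<inter> fst t) \<noteq> {}" by blast
    then have "s = t" using tiling_disjoint[OF T _ t(1)] sub by blast
    then show "t \<in> patch S x r" using s by simp
  qed
qed

end

section \<open>The tiling metric\<close>

definition agree_radii :: "('n::finite, 'l) tiling \<Rightarrow> ('n, 'l) tiling \<Rightarrow> real set" where
  "agree_radii S T = {\<epsilon>. \<epsilon> > 0 \<and> (\<exists>x1 x2. norm x1 \<le> \<epsilon> \<and> norm x2 \<le> \<epsilon> \<and>
     agree (1 / \<epsilon>) (translate x1 S) (translate x2 T))}"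

lemma tiling_dist_eq: "tiling_dist S T = Inf (insert (1 / sqrt 2) (agree_radii S T))"
  by (simp add: tiling_dist_def agree_radii_def agree_def)

lemma bdd_below_agree_radii: "bdd_below (agree_radii S T)"
  unfolding bdd_below_def by (rule exI[of _ 0]) (auto simp: agree_radii_def)

lemma tiling_dist_nonneg: "0 \<le> tiling_dist S T"
  unfolding tiling_dist_eq by (rule cInf_greatest) (auto simp: agree_radii_def)

lemma tiling_dist_le: "tiling_dist S T \<le> 1 / sqrt 2"
  unfolding tiling_dist_eq by (rule cInf_lower) (auto simp: bdd_below_agree_radii)

lemma agree_radii_commute: "agree_radii S T = agree_radii T S"
proof -
  have "agree_radii S T \<subseteq> agree_radii T S" for S T :: "('n::finite, 'l) tiling"
    unfolding agree_radii_def using agree_sym by blast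
  then show ?thesis by blast
qed

lemma tiling_dist_commute: "tiling_dist S T = tiling_dist T S"
  by (simp add: tiling_dist_eq agree_radii_commute[of S T])

lemma tiling_dist_le_if_mem: "e \<in> agree_radii S T \<Longrightarrow> tiling_dist S T \<le> e"
  unfolding tiling_dist_eq by (rule cInf_lower) (auto simp: bdd_below_agree_radii)

lemma tiling_dist_le_if_near:
  assumes "near e S T" "e > 0"
  shows "tiling_dist S T \<le> e"
proof -
  obtain u where u: "norm u \<le> e" "agree (1 / e) S (translate u T)"
    using assms(1) unfolding near_def by blast
  have "e \<in> agree_radii S T"
    unfolding agree_radii_def mem_Collect_eq using assms(2) u
    by (intro conjI exI[of _ "0 :: real^'a"] exI[of _ u]) simp_all
  then show ?thesis by (rule tiling_dist_le_if_mem)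
qed

lemma agree_radius_below:
  assumes "tiling_dist S T < e" "e \<le> 1 / sqrt 2"
  shows "\<exists>a\<in>agree_radii S T. a < e"
proof -
  have "\<exists>a\<in>insert (1 / sqrt 2) (agree_radii S T). a < e"
    using assms(1) unfolding tiling_dist_eq
    by (subst (asm) cInf_less_iff) (auto simp: bdd_below_agree_radii)
  then show ?thesis using assms(2) by auto
qed

lemma sq_le_half:
  fixes e :: real
  assumes "0 < e" "e \<le> 1 / sqrt 2"
  shows "e * e \<le> 1 / 2"
proof -
  have "e * e \<le> (1 / sqrt 2) * (1 / sqrt 2)"
    using assms by (intro mult_mono) auto
  then show ?thesis by simp
qed

text \<open>Merging the two shifts into one moves the ball of agreement by at most \<open>a\<close>; since
  \<open>a \<le> 1 / sqrt 2\<close>, doubling \<open>a\<close> makes up for this loss of radius.\<close>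

lemma near_if_tiling_dist_less:
  assumes "tiling_dist S T < e" "e \<le> 1 / sqrt 2"
  shows "near (2 * e) S T"
proof -
  obtain a where a: "a \<in> agree_radii S T" "a < e" using agree_radius_below[OF assms] by blast
  then obtain x1 x2 where x: "a > 0" "norm x1 \<le> a" "norm x2 \<le> a"
    "agree (1 / a) (translate x1 S) (translate x2 T)"
    by (auto simp: agree_radii_def)
  have "a * a \<le> 1 / 2" using a x assms(2) by (intro sq_le_half) auto
  then have "1 / (2 * a) + a \<le> 1 / a" using \<open>a > 0\<close> by (simp add: field_simps)
  then have "1 / (2 * a) + norm (- x1) \<le> 1 / a" using x(2) by simp
  then have "agree (1 / (2 * a)) (translate (- x1) (translate x1 S)) (translate (- x1) (translate x2 T))"
    by (rule agree_translate[OF x(4)])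
  then have "agree (1 / (2 * a)) S (translate (- x1 + x2) T)" by simp
  moreover have "norm (- x1 + x2) \<le> 2 * a"
    using norm_triangle_ineq[of "- x1" x2] x by simp
  ultimately have "near (2 * a) S T" unfolding near_def by blast
  then show ?thesis using a(2) \<open>a > 0\<close> by (auto intro: near_mono)
qed

text \<open>The triangle inequality costs a translation of the ball of agreement.  The cap
  \<open>1 / sqrt 2\<close> makes \<open>1 / a\<close> exceed \<open>1 / (a + b)\<close> by enough to absorb it.\<close>

lemma tiling_dist_triangle: "tiling_dist S U \<le> tiling_dist S T + tiling_dist T U"
proof (cases "tiling_dist S T + tiling_dist T U < 1 / sqrt 2")
  case False
  then show ?thesis using tiling_dist_le[of S U] by linarith
next
  case True
  show ?thesis
  proof (rule dense_ge)
    fix z assume "tiling_dist S T + tiling_dist T U < z"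
    then obtain z' where z': "tiling_dist S T + tiling_dist T U < z'" "z' \<le> z" "z' \<le> 1 / sqrt 2"
      using True by (intro that[of "min z (1 / sqrt 2)"]) auto
    define h where "h = (z' - tiling_dist S T - tiling_dist T U) / 2"
    have h: "h > 0" "tiling_dist S T + h + (tiling_dist T U + h) = z'"
      using z' by (auto simp: h_def field_simps)
    obtain a where a: "a \<in> agree_radii S T" "a < tiling_dist S T + h"
      using agree_radius_below[of S T "tiling_dist S T + h"] h z' tiling_dist_nonneg[of T U] by auto
    obtain b where b: "b \<in> agree_radii T U" "b < tiling_dist T U + h"
      using agree_radius_below[of T U "tiling_dist T U + h"] h z' tiling_dist_nonneg[of S T] by auto
    obtain x1 x2 where x: "a > 0" "norm x1 \<le> a" "norm x2 \<le> a"
      "agree (1 / a) (translate x1 S) (translate x2 T)"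
      using a(1) by (auto simp: agree_radii_def)
    obtain y1 y2 where y: "b > 0" "norm y1 \<le> b" "norm y2 \<le> b"
      "agree (1 / b) (translate y1 T) (translate y2 U)"
      using b(1) by (auto simp: agree_radii_def)
    have ab: "(a + b) * (a + b) \<le> 1 / 2"
      using a b h z' x y by (intro sq_le_half) auto
    have *: "1 / (p + q) + q \<le> 1 / p" if "p > 0" "q > 0" "(p + q) * (p + q) \<le> 1 / 2" for p q :: real
    proof -
      have "p * (p + q) \<le> (p + q) * (p + q)" using that by (intro mult_right_mono) auto
      then have "p * (p + q) \<le> 1" using that by linarith
      then have "q * (p * (p + q)) \<le> q * 1" using that by (intro mult_left_mono) auto
      then show ?thesis using that by (simp add: field_simps)
    qed
    have "agree (1 / (a + b)) (translate y1 (translate x1 S)) (translate y1 (translate x2 T))"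
      using *[of a b] x y ab by (intro agree_translate[OF x(4)]) auto
    moreover have "agree (1 / (a + b)) (translate x2 (translate y1 T)) (translate x2 (translate y2 U))"
      using *[of b a] x y ab by (intro agree_translate[OF y(4)]) (auto simp: add.commute)
    ultimately have "agree (1 / (a + b)) (translate (y1 + x1) S) (translate (x2 + y2) U)"
      by (simp add: agree_def add.commute)
    moreover have "norm (y1 + x1) \<le> a + b" "norm (x2 + y2) \<le> a + b"
      using x y norm_triangle_ineq[of y1 x1] norm_triangle_ineq[of x2 y2] by auto
    ultimately have "a + b \<in> agree_radii S U"
      unfolding agree_radii_def using x y by auto
    then have "tiling_dist S U \<le> a + b" by (rule tiling_dist_le_if_mem)
    then show "tiling_dist S U \<le> z" using a b h z' by linarith
  qed
qed

context fat_tiles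
begin

lemma rigid_diff:
  assumes "T \<in> tilings \<P>" "r > 0" "norm (u - v) < \<rho>" "agree r (translate u T) (translate v T)"
  shows "u = v"
proof -
  have "agree r (translate (u - v) (translate v T)) (translate v T)"
    using assms(4) by simp
  then have "u - v = 0" using rigid translate_tilings assms(1-3) by blast
  then show ?thesis by simp
qed

text \<open>Distance zero yields agreement up to shifts of every size.  By rigidity all sufficiently
  small ones coincide, so they are zero.\<close>

lemma eq_if_tiling_dist_zero:
  assumes S: "S \<in> tilings \<P>" and T: "T \<in> tilings \<P>" and "tiling_dist S T = 0"
  shows "S = T"
proof -
  have near: "near e S T" if "e > 0" for e
  proof -
    define d where "d = min e (1 / sqrt 2) / 2"
    have d: "d > 0" "2 * d \<le> e" "2 * d \<le> 1 / sqrt 2" using that by (auto simp: d_def)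
    then have "d \<le> 1 / sqrt 2" by linarith
    then have "near (2 * d) S T"
      using assms(3) d by (intro near_if_tiling_dist_less) auto
    then show ?thesis using d by (auto intro: near_mono)
  qed
  obtain u where u: "norm u \<le> \<rho> / 3" "agree (1 / (\<rho> / 3)) S (translate u T)"
    using near[of "\<rho> / 3"] rho_pos unfolding near_def by auto
  have *: "norm u \<le> e \<and> agree (1 / e) S (translate u T)" if "0 < e" "e \<le> \<rho> / 3" for e
  proof -
    obtain v where v: "norm v \<le> e" "agree (1 / e) S (translate v T)"
      using near[OF \<open>e > 0\<close>] unfolding near_def by auto
    have "1 / (\<rho> / 3) \<le> 1 / e" using that rho_pos by (intro frac_le) auto
    then have "agree (1 / (\<rho> / 3)) (translate u T) (translate v T)"
      using u(2) agree_mono[OF v(2)] agree_sym agree_trans by blast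
    moreover have "norm (u - v) < \<rho>"
      using u v that rho_pos norm_triangle_ineq4[of u v] by linarith
    ultimately have "u = v" using T rho_pos by (intro rigid_diff[of T "1 / (\<rho> / 3)"]) auto
    then show ?thesis using v by simp
  qed
  have "u = 0"
  proof (rule ccontr)
    assume "u \<noteq> 0"
    then have "norm u \<le> norm u / 2" using u(1) rho_pos by (intro conjunct1[OF *]) auto
    then show False using \<open>u \<noteq> 0\<close> by simp
  qed
  show "S = T"
  proof (rule eq_if_agree)
    fix r :: real assume "r > 0"
    define e where "e = min (1 / r) (\<rho> / 3)"
    have e: "e > 0" "e \<le> 1 / r" "e \<le> \<rho> / 3" using \<open>r > 0\<close> rho_pos by (auto simp: e_def)
    then have "r \<le> 1 / e" using \<open>r > 0\<close> by (simp add: field_simps)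
    then show "\<exists>s\<ge>r. agree s S T" using *[OF e(1,3)] \<open>u = 0\<close> by auto
  qed (use tile_nonempty tiling_tile S T in blast)+
qed

sublocale M: Metric_space "tilings \<P>" tiling_dist
proof
  show "tiling_dist S T = 0 \<longleftrightarrow> S = T" if "S \<in> tilings \<P>" "T \<in> tilings \<P>" for S T
  proof
    assume "S = T"
    then have "tiling_dist S T \<le> e" if "e > 0" for e
      using that near_refl[of e S] tiling_dist_le_if_near by blast
    then have "tiling_dist S T \<le> 0" by (rule dense_ge)
    then show "tiling_dist S T = 0" using tiling_dist_nonneg[of S T] by linarith
  qed (use that eq_if_tiling_dist_zero in blast)
qed (rule tiling_dist_nonneg tiling_dist_commute tiling_dist_triangle)+

text \<open>The limit is the union of the nested patches of \<open>S n\<close> of radius \<open>n\<close>.  Any two of its tiles belong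
  to a common \<open>S n\<close>, which keeps their interiors apart.\<close>

lemma limit_tiling:
  assumes S: "\<And>n. S n \<in> tilings \<P>" and step: "\<And>n. agree (real n) (S n) (S (Suc n))"
  shows "\<exists>L\<in>tilings \<P>. \<forall>n. agree (real n) (S n) L"
proof -
  have coh: "patch (S m) 0 (real n) = patch (S n) 0 (real n)" if "n \<le> m" for m n
    using that
  proof (induction m rule: dec_induct)
    case (step m)
    have "agree (real n) (S m) (S (Suc m))"
      using assms(2)[of m] step by (auto intro: agree_mono)
    then show ?case using step by (simp add: agree_def)
  qed simp
  define L where "L = (\<Union>n. patch (S n) 0 (real n))"
  have L: "patch L 0 (real n) = patch (S n) 0 (real n)" for n
  proof (intro subset_antisym subsetI)
    fix t assume t: "t \<in> patch L 0 (real n)"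
    then obtain m where m: "t \<in> patch (S m) 0 (real m)"
      unfolding L_def patch_def by blast
    have "patch (S m) 0 (real m) = patch (S (max m n)) 0 (real m)" using coh[of m "max m n"] by simp
    then have "t \<in> patch (S (max m n)) 0 (real n)" using t m by (auto simp: patch_def)
    then show "t \<in> patch (S n) 0 (real n)" using coh[of n "max m n"] by simp
  next
    fix t assume t: "t \<in> patch (S n) 0 (real n)"
    then show "t \<in> patch L 0 (real n)"
      unfolding L_def by (auto simp: patch_def)
  qed
  have sub: "\<exists>n. t \<in> S n \<and> s \<in> S n" if "s \<in> L" "t \<in> L" for s t
  proof -
    obtain m n where mn: "s \<in> patch (S m) 0 (real m)" "t \<in> patch (S n) 0 (real n)"
      using \<open>s \<in> L\<close> \<open>t \<in> L\<close> unfolding L_def by blast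
    have "s \<in> patch (S (max m n)) 0 (real m)" "t \<in> patch (S (max m n)) 0 (real n)"
      using mn coh[of m "max m n"] coh[of n "max m n"] by simp_all
    then show ?thesis using patch_subset by blast
  qed
  have "L \<in> tilings \<P>"
    unfolding tilings_def mem_Collect_eq
  proof (intro conjI ballI impI)
    show "L \<subseteq> \<Union>\<P>" using sub tiling_tile[OF S] by blast
    show "(\<Union>t\<in>L. fst t) = UNIV"
    proof (intro equalityI subsetI)
      fix x :: "real^'n"
      obtain n where n: "norm x < real n" using reals_Archimedean2 by blast
      obtain t where "t \<in> S n" "x \<in> fst t" using tiling_cover[OF S] by blast
      then have "t \<in> patch (S n) 0 (real n)" using n by (auto simp: mem_patch intro!: exI[of _ x])
      then show "x \<in> (\<Union>t\<in>L. fst t)" using \<open>x \<in> fst t\<close> unfolding L_def by blast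
    qed simp
    fix s t assume st: "s \<in> L" "t \<in> L" "s \<noteq> t"
    then obtain n where "t \<in> S n" "s \<in> S n" using sub by blast
    then show "interior (fst s \<inter> fst t) = {}" using tiling_disjoint[OF S] st(3) by blast
  qed
  moreover have "agree (real n) (S n) L" for n by (simp add: agree_def L)
  ultimately show ?thesis by blast
qed

text \<open>Along a subsequence with rapidly decreasing distances, consecutive tilings agree on growing
  balls after small shifts \<open>u n\<close>.  Translating by the tail sums of these shifts makes the agreement
  exact without changing the limit.\<close>

lemma mcomplete_tilings: "M.mcomplete"
  unfolding M.mcomplete_def
proof (intro allI impI)
  fix \<sigma> assume cau: "M.MCauchy \<sigma>"
  \<comment> \<open>then \<open>2 * \<epsilon> n\<close>, the bound for the \<open>n\<close>-th shift, is \<open>(1/2) ^ Suc n\<close>, with tail sums \<open>(1/2) ^ n\<close>\<close>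
  define \<epsilon> where "\<epsilon> n = (1 / 2 :: real) ^ (n + 2)" for n
  have "\<exists>N. \<forall>m\<ge>N. \<forall>m'\<ge>N. tiling_dist (\<sigma> m) (\<sigma> m') < \<epsilon> n" for n
    using cau unfolding M.MCauchy_def by (metis \<epsilon>_def half_gt_zero zero_less_one zero_less_power)
  then obtain N where N: "\<And>n m m'. m \<ge> N n \<Longrightarrow> m' \<ge> N n \<Longrightarrow> tiling_dist (\<sigma> m) (\<sigma> m') < \<epsilon> n"
    by metis
  define r where "r n = (\<Sum>k\<le>n. N k) + n" for n
  have r: "strict_mono r" unfolding r_def by (rule strict_mono_Suc_iff[THEN iffD2]) simp
  have rN: "r n \<ge> N n" "r (Suc n) \<ge> N n" for n
    using member_le_sum[of n "{..n}" N] by (auto simp: r_def)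
  define \<tau> where "\<tau> = \<sigma> \<circ> r"
  have \<tau>: "\<tau> n \<in> tilings \<P>" for n using cau unfolding M.MCauchy_def \<tau>_def by auto
  have "near (2 * \<epsilon> n) (\<tau> n) (\<tau> (Suc n))" for n
  proof (rule near_if_tiling_dist_less)
    show "tiling_dist (\<tau> n) (\<tau> (Suc n)) < \<epsilon> n" unfolding \<tau>_def using N rN by simp
    have "\<epsilon> n \<le> (1/2) ^ 2" unfolding \<epsilon>_def by (rule power_decreasing) auto
    also have "\<dots> \<le> 1 / 2" by (simp add: power2_eq_square)
    also have "\<dots> \<le> 1 / sqrt 2" by (simp add: real_le_lsqrt frac_le)
    finally show "\<epsilon> n \<le> 1 / sqrt 2" .
  qed
  moreover have "2 * \<epsilon> n = (1/2) ^ Suc n" for n by (simp add: \<epsilon>_def)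
  ultimately have "\<exists>u. norm u \<le> (1/2) ^ Suc n \<and> agree (1 / (1/2) ^ Suc n) (\<tau> n) (translate u (\<tau> (Suc n)))" for n
    unfolding near_def by simp
  then obtain u where u: "\<And>n. norm (u n) \<le> (1/2) ^ Suc n"
    "\<And>n. agree (1 / (1/2) ^ Suc n) (\<tau> n) (translate (u n) (\<tau> (Suc n)))"
    by metis
  have geo: "(\<lambda>k. (1/2 :: real) ^ Suc (n + k)) sums ((1/2) ^ n)" for n
  proof -
    have "(\<lambda>k. (1/2 :: real) ^ Suc n * (1/2) ^ k) sums ((1/2) ^ Suc n * (1 / (1 - 1/2)))"
      by (intro sums_mult geometric_sums) simp
    then show ?thesis by (simp add: power_add)
  qed
  have sm: "summable (\<lambda>k. u (n + k))" for n
    by (rule summable_comparison_test'[of "\<lambda>k. (1/2 :: real) ^ Suc (n + k)" 0])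
       (use geo[of n] u(1) in \<open>auto simp: sums_iff simp del: power_Suc\<close>)
  define a where "a n = - (\<Sum>k. u (n + k))" for n
  have a_Suc: "a (Suc n) = a n + u n" for n
    using suminf_split_head[OF sm[of n]] by (simp add: a_def)
  have a_le: "norm (a n) \<le> (1/2) ^ n" for n
    unfolding a_def norm_minus_cancel using geo[of n] u(1)
    by (metis (no_types, lifting) norm_suminf_le sums_iff)
  have a_le1: "norm (a n) \<le> 1" for n
    using a_le[of n] power_le_one[of "1/2 :: real" n] by simp
  have "\<exists>L\<in>tilings \<P>. \<forall>n. agree (real n) (translate (a n) (\<tau> n)) L"
  proof (rule limit_tiling)
    show "translate (a n) (\<tau> n) \<in> tilings \<P>" for n using translate_tilings \<tau> .
    fix n
    have "real (Suc n) \<le> 2 ^ Suc n"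
      using of_nat_less_two_power[of "Suc n"] less_imp_le by blast
    then have "real n + norm (a n) \<le> 1 / (1/2) ^ Suc n"
      using a_le1[of n] by (simp add: power_one_over)
    then have "agree (real n) (translate (a n) (\<tau> n)) (translate (a n) (translate (u n) (\<tau> (Suc n))))"
      by (rule agree_translate[OF u(2)])
    then show "agree (real n) (translate (a n) (\<tau> n)) (translate (a (Suc n)) (\<tau> (Suc n)))"
      by (simp add: a_Suc)
  qed
  then obtain L where L: "L \<in> tilings \<P>" "\<And>n. agree (real n) (translate (a n) (\<tau> n)) L" by blast
  have "\<exists>K. \<forall>n\<ge>K. tiling_dist (\<tau> n) L < e" if "e > 0" for e
  proof -
    define d where "d = e / 2"
    have "d > 0" "d < e" using that by (auto simp: d_def)
    obtain K1 where K1: "1 / d + 1 < real K1" using reals_Archimedean2 by blast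
    obtain K2 where K2: "(1/2) ^ K2 < d" using \<open>d > 0\<close> real_arch_pow_inv[of d "1/2"] by auto
    have "tiling_dist (\<tau> n) L < e" if "n \<ge> max K1 K2" for n
    proof -
      have "1 / d + norm (- a n) \<le> real n" using K1 a_le1[of n] that by simp
      then have "agree (1 / d) (translate (- a n) (translate (a n) (\<tau> n))) (translate (- a n) L)"
        by (rule agree_translate[OF L(2)])
      moreover have "norm (- a n) \<le> d"
      proof -
        have "(1/2 :: real) ^ n \<le> (1/2) ^ K2" using that by (intro power_decreasing) auto
        then have "norm (a n) \<le> d" using a_le[of n] K2 by linarith
        then show ?thesis by simp
      qed
      ultimately have "near d (\<tau> n) L" unfolding near_def by (intro exI[of _ "- a n"]) simp
      then show ?thesis using tiling_dist_le_if_near \<open>d > 0\<close> \<open>d < e\<close> by fastforce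
    qed
    then show ?thesis by blast
  qed
  then have "limitin M.mtopology \<tau> L sequentially"
    unfolding M.limit_metric_sequentially using L(1) \<tau> by blast
  then show "\<exists>L. limitin M.mtopology \<sigma> L sequentially"
    unfolding \<tau>_def using M.MCauchy_convergent_subsequence[OF cau r] by blast
qed

text \<open>The small shift that the metric tolerates can be absorbed into the translate of \<open>T\<close>: a tiling
  of the hull agrees exactly with translates of \<open>T\<close> on balls.\<close>

lemma tiling_hull_eq:
  assumes T: "T \<in> tilings \<P>"
  shows "tiling_hull \<P> T = {S \<in> tilings \<P>. \<forall>r. \<exists>x. agree r S (translate x T)}" (is "_ = ?R")
proof -
  have "tiling_hull \<P> T = {S \<in> tilings \<P>. \<forall>e>0. \<exists>x. tiling_dist S (translate x T) < e}"
    unfolding tiling_hull_def tilings_topology_def M.metric_closure_of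
    using translate_tilings[OF T] by auto
  also have "\<dots> = ?R"
  proof (intro Collect_cong conj_cong refl iffI allI impI)
    fix S r assume S: "\<forall>e>0. \<exists>x. tiling_dist S (translate x T) < e"
    define e where "e = min (1 / sqrt 2) (1 / (2 * (\<bar>r\<bar> + 1)))"
    have e: "e > 0" "e \<le> 1 / sqrt 2" "e \<le> 1 / (2 * (\<bar>r\<bar> + 1))" by (auto simp: e_def)
    obtain x where "tiling_dist S (translate x T) < e" using S e by blast
    then have "near (2 * e) S (translate x T)" using e near_if_tiling_dist_less by blast
    then obtain u where "agree (1 / (2 * e)) S (translate (u + x) T)" unfolding near_def by auto
    moreover have "r \<le> 1 / (2 * e)"
    proof -
      have "(\<bar>r\<bar> + 1) * (2 * e) \<le> 1" using e by (simp add: field_simps)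
      then have "\<bar>r\<bar> + 1 \<le> 1 / (2 * e)" using e(1) by (simp add: field_simps)
      then show ?thesis by linarith
    qed
    ultimately show "\<exists>x. agree r S (translate x T)" using agree_mono by blast
  next
    fix S and e :: real assume S: "\<forall>r. \<exists>x. agree r S (translate x T)" and "e > 0"
    obtain x where "agree (1 / (e / 2)) S (translate x T)" using S by blast
    then have "near (e / 2) S (translate x T)"
      unfolding near_def using \<open>e > 0\<close> by (intro exI[of _ 0]) simp
    then have "tiling_dist S (translate x T) \<le> e / 2" using \<open>e > 0\<close> by (intro tiling_dist_le_if_near) auto
    moreover have "e / 2 < e" using \<open>e > 0\<close> by simp
    ultimately show "\<exists>x. tiling_dist S (translate x T) < e" using le_less_trans by blast
  qed
  finally show ?thesis .
qed

end

section \<open>Hulls of repetitive tilings with finite local complexity\<close>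

locale flc_hull = fat_tiles \<P> \<rho> D
  for \<P> :: "('n::finite, 'l) tile set set" and \<rho> D :: real +
  fixes T :: "('n, 'l) tiling" and \<Omega> :: "('n, 'l) tiling set"
  assumes T: "T \<in> tilings \<P>" and aper: "aperiodic T" and rep: "repetitive T"
    and flc: "finite_local_complexity T" and hull: "\<Omega> = tiling_hull \<P> T"
begin

lemma hull_iff: "S \<in> \<Omega> \<longleftrightarrow> S \<in> tilings \<P> \<and> (\<forall>r. \<exists>x. agree r S (translate x T))"
  by (simp add: hull tiling_hull_eq[OF T])

lemma hull_tilings: "S \<in> \<Omega> \<Longrightarrow> S \<in> tilings \<P>"
  by (simp add: hull_iff)

lemma orbit_in_hull: "translate x T \<in> \<Omega>"
  unfolding hull_iff using translate_tilings[OF T] by (auto intro: agree_refl)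

lemma hull_agree: "S \<in> \<Omega> \<Longrightarrow> \<exists>x. agree r S (translate x T)"
  by (simp add: hull_iff)

lemma translate_hull: "S \<in> \<Omega> \<Longrightarrow> translate v S \<in> \<Omega>"
proof -
  assume S: "S \<in> \<Omega>"
  have "\<exists>x. agree r (translate v S) (translate x T)" for r
  proof -
    obtain x where "agree (r + norm v) S (translate x T)" using hull_agree[OF S] by blast
    then have "agree r (translate v S) (translate v (translate x T))"
      by (rule agree_translate) simp
    then show ?thesis by auto
  qed
  then show ?thesis using translate_tilings hull_tilings[OF S] by (simp add: hull_iff)
qed

definition patch_class :: "real \<Rightarrow> real^'n \<Rightarrow> ('n, 'l) tiling set" where
  "patch_class r x = {Q. \<exists>v. Q = translate v (patch T x r)}"

lemma finite_range_patch_class: "r > 0 \<Longrightarrow> finite (range (patch_class r))"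
proof -
  assume "r > 0"
  then have "finite (range (\<lambda>x. patch T x r) // {(P, Q). \<exists>v. Q = translate v P})"
    using flc by (simp add: finite_local_complexity_def)
  moreover have "range (\<lambda>x. patch T x r) // {(P, Q). \<exists>v. Q = translate v P} = range (patch_class r)"
    by (auto simp: quotient_def patch_class_def Image_def)
  ultimately show ?thesis by simp
qed

lemma patch_class_eq:
  assumes "patch_class r x = patch_class r y"
  shows "\<exists>v. patch T x r = translate v (patch T y r)"
proof -
  have "patch T x r \<in> patch_class r x"
    unfolding patch_class_def by (auto intro: exI[of _ 0])
  then show ?thesis using assms unfolding patch_class_def by blast
qed

text \<open>Two places of \<open>T\<close> with equivalent patches may see them at different positions relative
  to the origin.  These positions range over a bounded set, so finitely many pairs of a patch class
  and an approximate position describe all of the orbit up to a given precision.\<close>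

lemma hull_finite_net:
  assumes "e > 0"
  shows "\<exists>F. finite F \<and> F \<subseteq> range (\<lambda>x. translate x T) \<and> (\<forall>S\<in>\<Omega>. \<exists>X\<in>F. near e S X)"
proof -
  \<comment> \<open>the extra \<open>e\<close> pays for translating by an error of size \<open>e\<close> in the position\<close>
  define R where "R = 1 / e + e"
  have "R > 0" using assms by (simp add: R_def add_pos_pos)
  define rep where "rep x = (SOME y. patch_class R y = patch_class R x)" for x
  have rep: "patch_class R (rep x) = patch_class R x" for x
    unfolding rep_def by (rule someI[of _ x]) simp
  have rep_cong: "rep x = rep y" if "patch_class R x = patch_class R y" for x y
    using that by (simp add: rep_def)
  have "\<exists>w. patch (translate x T) 0 R = translate w (patch (translate (rep x) T) 0 R)" for x
  proof -
    obtain v where "patch T x R = translate v (patch T (rep x) R)"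
      using patch_class_eq rep by metis
    then have "patch (translate x T) 0 R = translate (x + v - rep x) (patch (translate (rep x) T) 0 R)"
      by (simp add: patch_translate)
    then show ?thesis by blast
  qed
  then obtain w where w: "\<And>x. patch (translate x T) 0 R = translate (w x) (patch (translate (rep x) T) 0 R)"
    by metis
  have w_le: "norm (w x) \<le> R + D" for x
  proof -
    obtain t where t: "t \<in> translate (rep x) T" "0 \<in> fst t"
      using tiling_cover[OF translate_tilings[OF T]] by blast
    then have "t \<in> patch (translate (rep x) T) 0 R" using \<open>R > 0\<close> by (auto simp: mem_patch)
    then have "translate_tile (w x) t \<in> patch (translate x T) 0 R"
      unfolding w[of x] by (simp add: mem_translate)
    then obtain y where y: "norm y < R" "y + w x \<in> fst t"
      by (auto simp: mem_patch in_fst_translate_tile)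
    have "dist (y + w x) 0 \<le> D"
      using diam_tile tiling_tile[OF translate_tilings[OF T] t(1)] y t(2) by blast
    then show ?thesis using y(1) norm_triangle_ineq4[of "y + w x" y] by simp
  qed
  have "compact (cball (0 :: real^'n) (R + D))" by simp
  then obtain K :: "(real^'n) set" where K: "finite K" "cball 0 (R + D) \<subseteq> (\<Union>k\<in>K. ball k (e / 2))"
    unfolding compact_eq_totally_bounded using assms half_gt_zero by metis
  have "\<exists>k\<in>K. w x \<in> ball k (e / 2)" for x
    using K(2) w_le[of x] by (auto simp: subset_iff)
  then obtain j where j: "\<And>x. j x \<in> K" "\<And>x. w x \<in> ball (j x) (e / 2)" by metis
  define f where "f x = (patch_class R x, j x)" for x
  have "range f \<subseteq> range (patch_class R) \<times> K" using j by (auto simp: f_def)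
  then have fin: "finite (range f)"
    using finite_range_patch_class[OF \<open>R > 0\<close>] K(1) finite_subset by blast
  have near: "near e (translate x T) (translate y T)" if "f x = f y" for x y
  proof -
    have "patch_class R x = patch_class R y" and j_eq: "j x = j y" using that by (simp_all add: f_def)
    then have rep_eq: "rep x = rep y" by (intro rep_cong)
    define u where "u = w x - w y"
    have u: "norm u \<le> e"
    proof -
      have "dist (w x) (w y) < e"
        using j(2)[of x] j(2)[of y] j_eq dist_triangle_half_r[of "j x" "w x" e "w y"] by simp
      then show ?thesis by (simp add: u_def dist_norm)
    qed
    have "patch (translate x T) 0 R = translate u (patch (translate y T) 0 R)"
      unfolding w[of x] w[of y] by (simp add: rep_eq u_def)
    then have "patch (translate x T) 0 R = patch (translate u (translate y T)) (- u) R"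
      by (simp only: patch_translate) simp
    then have "patch (translate x T) 0 (1 / e) = patch (translate u (translate y T)) 0 (1 / e)"
    proof (rule patch_eq_on_ball)
      show "ball 0 (1 / e) \<subseteq> ball (0 :: real^'n) R" using assms by (simp add: R_def subset_ball)
      show "ball 0 (1 / e) \<subseteq> ball (- u) R"
        using u assms by (intro ball_subset_ball_iff[THEN iffD2]) (auto simp: R_def)
    qed
    then show ?thesis unfolding near_def agree_def using u by blast
  qed
  define F where "F = (\<lambda>c. translate (SOME y. f y = c) T) ` range f"
  have "\<exists>X\<in>F. near e S X" if S: "S \<in> \<Omega>" for S
  proof -
    obtain x where x: "agree (1 / e) S (translate x T)" using hull_agree[OF S] by blast
    have "f (SOME y. f y = f x) = f x" by (rule someI[of _ x]) simp
    then have "near e (translate x T) (translate (SOME y. f y = f x) T)" using near by metis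
    then have "near e S (translate (SOME y. f y = f x) T)"
      unfolding near_def using x agree_trans by blast
    then show ?thesis unfolding F_def by blast
  qed
  moreover have "finite F" "F \<subseteq> range (\<lambda>x. translate x T)" using fin unfolding F_def by auto
  ultimately show ?thesis by blast
qed

lemma compactin_hull: "compactin M.mtopology \<Omega>"
proof -
  have "M.mtotally_bounded (range (\<lambda>x. translate x T))"
    unfolding M.mtotally_bounded_def
  proof (intro allI impI)
    fix e :: real assume "e > 0"
    obtain F where F: "finite F" "F \<subseteq> range (\<lambda>x. translate x T)" "\<forall>S\<in>\<Omega>. \<exists>X\<in>F. near (e / 2) S X"
      using hull_finite_net[of "e / 2"] \<open>e > 0\<close> by auto
    have "translate x T \<in> (\<Union>X\<in>F. M.mball X e)" for x
    proof -
      obtain X where X: "X \<in> F" "near (e / 2) (translate x T) X" using F orbit_in_hull by blast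
      then have "tiling_dist (translate x T) X \<le> e / 2"
        using \<open>e > 0\<close> by (intro tiling_dist_le_if_near) auto
      then have "tiling_dist X (translate x T) < e"
        using \<open>e > 0\<close> tiling_dist_commute[of X "translate x T"] by linarith
      moreover have "X \<in> tilings \<P>" using X(1) F(2) translate_tilings[OF T] by blast
      ultimately show ?thesis using X(1) translate_tilings[OF T] by auto
    qed
    then show "\<exists>K. finite K \<and> K \<subseteq> range (\<lambda>x. translate x T) \<and>
        range (\<lambda>x. translate x T) \<subseteq> (\<Union>x\<in>K. M.mball x e)"
      using F by (intro exI[of _ F]) blast
  qed
  then show ?thesis
    using M.mtotally_bounded_eq_compact_closure_of[OF mcomplete_tilings]
    by (simp add: hull tiling_hull_def tilings_topology_def)
qed

text \<open>Repetitivity yields one radius per patch, and by finite local complexity only finitely many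
  patches of a given size matter, so a single radius serves all places of \<open>T\<close>.\<close>

lemma uniformly_repetitive_orbit:
  assumes "r > 0"
  shows "\<exists>R>0. \<forall>x z. \<exists>y. norm y < R \<and> agree r (translate (z + y) T) (translate x T)"
proof -
  have "\<exists>R>0. \<forall>z. \<exists>v. translate v (patch T x r) \<subseteq> patch T z R" for x
    using rep[unfolded repetitive_def, rule_format, OF conjI, OF finite_patch[OF T] patch_subset] .
  then obtain Rf where Rf: "\<And>x. Rf x > 0"
    "\<And>x z. \<exists>v. translate v (patch T x r) \<subseteq> patch T z (Rf x)" by metis
  define rep where "rep x = (SOME y. patch_class r y = patch_class r x)" for x
  have rep: "patch_class r (rep x) = patch_class r x" for x
    unfolding rep_def by (rule someI[of _ x]) simp
  have "range (Rf \<circ> rep) = (\<lambda>c. Rf (SOME y. patch_class r y = c)) ` range (patch_class r)"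
    by (auto simp: rep_def)
  then have fin: "finite (range (Rf \<circ> rep))" using finite_range_patch_class[OF assms] by simp
  define R where "R = Max (range (Rf \<circ> rep))"
  have R: "Rf (rep x) \<le> R" for x unfolding R_def using fin by (intro Max_ge) auto
  have "R > 0" using Rf(1) R less_le_trans by blast
  have "\<exists>y. norm y < R + D \<and> agree r (translate (z + y) T) (translate x T)" for x z
  proof -
    obtain u where u: "patch T (rep x) r = translate u (patch T x r)"
      using patch_class_eq rep by metis
    obtain v' where "translate v' (patch T (rep x) r) \<subseteq> patch T z (Rf (rep x))" using Rf(2) by blast
    moreover have "patch T z (Rf (rep x)) \<subseteq> patch T z R" using R[of x] by (fastforce simp: patch_def)
    ultimately obtain v where v: "translate v (patch T x r) \<subseteq> patch T z R"
      using u by (metis order_trans translate_add)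
    have eq: "translate v (patch T x r) = patch (translate v T) (x - v) r"
      by (simp add: patch_translate)
    have "patch (translate v T) (x - v) r = patch T (x - v) r"
      using v patch_subset[of T z R] unfolding eq
      by (intro patch_determined translate_tilings T) blast
    then have "patch T (x - v) r = translate v (patch T x r)" by (simp only: eq)
    then have "patch (translate (x - v) T) 0 r = patch (translate x T) 0 r"
      by (simp add: patch_translate)
    then have "agree r (translate (z + (x - v - z)) T) (translate x T)" by (simp add: agree_def)
    moreover have "norm (x - v - z) < R + D"
    proof -
      obtain t where t: "t \<in> T" "x \<in> fst t" using tiling_cover[OF T] by blast
      then have "t \<in> patch T x r" using assms by (auto simp: mem_patch)
      then have "translate_tile v t \<in> translate v (patch T x r)" by (simp add: mem_translate)
      then have "translate_tile v t \<in> patch T z R" using v by (rule rev_subsetD)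
      then obtain y where y: "dist z y < R" "y + v \<in> fst t"
        by (auto simp: mem_patch in_fst_translate_tile)
      have "dist x (y + v) \<le> D" using diam_tile tiling_tile[OF T t(1)] y t(2) by blast
      moreover have "x - v - z = (x - (y + v)) + (y - z)" by simp
      then have "norm (x - v - z) \<le> norm (x - (y + v)) + norm (y - z)"
        by (metis norm_triangle_ineq)
      ultimately show ?thesis using y(1) by (simp add: dist_norm norm_minus_commute)
    qed
    ultimately show ?thesis by blast
  qed
  moreover have "R + D > 0" using \<open>R > 0\<close> D_pos by simp
  ultimately show ?thesis by blast
qed

lemma uniformly_repetitive:
  assumes "r > 0"
  shows "\<exists>R>0. \<forall>S\<in>\<Omega>. \<forall>S0\<in>\<Omega>. \<exists>y. norm y < R \<and> agree r (translate y S) S0"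
proof -
  obtain R where R: "R > 0" "\<And>x z. \<exists>y. norm y < R \<and> agree r (translate (z + y) T) (translate x T)"
    using uniformly_repetitive_orbit[OF assms] by blast
  have "\<exists>y. norm y < R \<and> agree r (translate y S) S0" if S: "S \<in> \<Omega>" and S0: "S0 \<in> \<Omega>" for S S0
  proof -
    obtain x0 where x0: "agree r S0 (translate x0 T)" using hull_agree[OF S0] by blast
    obtain z where z: "agree (r + R) S (translate z T)" using hull_agree[OF S] by blast
    obtain y where y: "norm y < R" "agree r (translate (z + y) T) (translate x0 T)" using R(2) by blast
    have "agree r (translate y S) (translate y (translate z T))"
      using y(1) by (intro agree_translate[OF z]) simp
    then have "agree r (translate y S) S0"
      using y(2) x0 by (simp add: agree_def add.commute)
    then show ?thesis using y(1) by blast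
  qed
  then show ?thesis using R(1) by blast
qed

end

definition near_continuous ::
  "('n::finite, 'l) tiling set \<Rightarrow> (('n, 'l) tiling \<Rightarrow> ('n, 'k) tiling) \<Rightarrow> bool" where
  "near_continuous \<Omega> h \<longleftrightarrow>
     (\<forall>e>0. \<exists>d>0. \<forall>S\<in>\<Omega>. \<forall>T\<in>\<Omega>. near d S T \<longrightarrow> near e (h S) (h T))"

text \<open>Uniform continuity on the compact hull, restated without the metric.\<close>

lemma near_continuous_if_continuous_map:
  fixes \<P>' :: "('n::finite, 'k) tile set set"
  assumes X: "flc_hull \<P> \<rho> D T \<Omega>" and Y: "fat_tiles \<P>' \<rho>' D'" and "\<Omega>' \<subseteq> tilings \<P>'"
    and cont: "continuous_map (subtopology (tilings_topology \<P>) \<Omega>)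
      (subtopology (tilings_topology \<P>') \<Omega>') h"
  shows "near_continuous \<Omega> h"
proof -
  interpret X: flc_hull \<P> \<rho> D T \<Omega> by (rule X)
  interpret Y: fat_tiles \<P>' \<rho>' D' by (rule Y)
  have sub: "\<Omega> \<subseteq> tilings \<P>" using X.hull_tilings by blast
  interpret SX: Submetric "tilings \<P>" tiling_dist \<Omega> by unfold_locales (rule sub)
  interpret SY: Submetric "tilings \<P>'" tiling_dist \<Omega>' by unfold_locales (rule assms(3))
  have "continuous_map SX.sub.mtopology SY.sub.mtopology h"
    using cont unfolding tilings_topology_def SX.mtopology_submetric SY.mtopology_submetric .
  moreover have "compact_space SX.sub.mtopology"
    unfolding SX.mtopology_submetric using X.compactin_hull by (simp add: compactin_subspace)
  ultimately have "uniformly_continuous_map (metric (\<Omega>, tiling_dist)) (metric (\<Omega>', tiling_dist)) h"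
    by (intro continuous_imp_uniformly_continuous_map) simp
  then have uc: "\<exists>d>0. \<forall>S\<in>\<Omega>. \<forall>T\<in>\<Omega>. tiling_dist T S < d \<longrightarrow> tiling_dist (h T) (h S) < e"
    if "e > 0" for e
    using that unfolding uniformly_continuous_map_def by simp
  show ?thesis
    unfolding near_continuous_def
  proof (intro allI impI)
    fix e :: real assume "e > 0"
    define c where "c = min (e / 2) (1 / sqrt 2)"
    have c: "c > 0" "2 * c \<le> e" "c \<le> 1 / sqrt 2" using \<open>e > 0\<close> by (auto simp: c_def)
    obtain d where d: "d > 0"
      "\<And>S T. S \<in> \<Omega> \<Longrightarrow> T \<in> \<Omega> \<Longrightarrow> tiling_dist T S < d \<Longrightarrow> tiling_dist (h T) (h S) < c"
      using uc[OF c(1)] by blast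
    have "near e (h S) (h T)" if "S \<in> \<Omega>" "T \<in> \<Omega>" "near (d / 2) S T" for S T
    proof -
      have "tiling_dist S T \<le> d / 2" using that(3) d(1) by (intro tiling_dist_le_if_near) auto
      then have "tiling_dist (h S) (h T) < c" using d that by simp
      then have "near (2 * c) (h S) (h T)" using c(3) by (rule near_if_tiling_dist_less)
      then show ?thesis using c by (auto intro: near_mono)
    qed
    moreover have "d / 2 > 0" using d(1) by simp
    ultimately show "\<exists>d>0. \<forall>S\<in>\<Omega>. \<forall>T\<in>\<Omega>. near d S T \<longrightarrow> near e (h S) (h T)" by blast
  qed
qed

section \<open>Lifting small translations through a continuous map\<close>

text \<open>From here on the geometry of tiles enters only through rigidity: a tiling does not agree with
  a nearby translate of itself.\<close>

locale tiling_system =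
  fixes \<Omega> :: "('n::finite, 'l) tiling set" and \<kappa> :: real
  assumes kappa_pos: "\<kappa> > 0"
    and invariant: "\<And>S x. S \<in> \<Omega> \<Longrightarrow> translate x S \<in> \<Omega>"
    and tile_nonempty: "\<And>S t. S \<in> \<Omega> \<Longrightarrow> t \<in> S \<Longrightarrow> fst t \<noteq> {}"
    and rigid: "\<And>S r u v. S \<in> \<Omega> \<Longrightarrow> r > 0 \<Longrightarrow> norm (u - v) < \<kappa> \<Longrightarrow>
      agree r (translate u S) (translate v S) \<Longrightarrow> u = v"

lemma flc_hull_tiling_system:
  assumes "flc_hull \<P> \<rho> D T \<Omega>"
  shows "tiling_system \<Omega> \<rho>"
proof -
  interpret flc_hull \<P> \<rho> D T \<Omega> by (rule assms)
  show ?thesis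
  proof
    show "u = v" if "S \<in> \<Omega>" "r > 0" "norm (u - v) < \<rho>" "agree r (translate u S) (translate v S)"
      for S r u v
      using rigid_diff hull_tilings that by blast
    show "fst t \<noteq> {}" if "S \<in> \<Omega>" "t \<in> S" for S t
      using tile_nonempty tiling_tile hull_tilings that by blast
  qed (use rho_pos translate_hull in blast)+
qed

lemma subdivide_vector:
  fixes x :: "'a::real_normed_vector"
  assumes "\<delta> > 0"
  shows "\<exists>N s. x = real N *\<^sub>R s \<and> norm s \<le> \<delta> \<and> real N \<le> norm x / \<delta> + 1"
proof -
  define N where "N = nat \<lfloor>norm x / \<delta>\<rfloor> + 1"
  have fl: "\<lfloor>norm x / \<delta>\<rfloor> \<ge> 0" using assms by simp
  then have N: "real N = of_int \<lfloor>norm x / \<delta>\<rfloor> + 1" by (simp add: N_def)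
  then have le: "real N \<le> norm x / \<delta> + 1" and ge: "norm x / \<delta> \<le> real N" by linarith+
  have pos: "real N > 0" by (simp add: N_def)
  have "norm ((1 / real N) *\<^sub>R x) \<le> \<delta>"
    using ge pos assms by (simp add: field_simps)
  moreover have "x = real N *\<^sub>R ((1 / real N) *\<^sub>R x)" using pos by simp
  ultimately show ?thesis using le by blast
qed

locale tiling_map =
  X: tiling_system \<Omega> \<kappa> + Y: tiling_system \<Omega>' \<kappa>'
  for \<Omega> :: "('n::finite, 'l) tiling set" and \<kappa> :: real
    and \<Omega>' :: "('n, 'k) tiling set" and \<kappa>' :: real +
  fixes h :: "('n, 'l) tiling \<Rightarrow> ('n, 'k) tiling"
  assumes into: "\<And>S. S \<in> \<Omega> \<Longrightarrow> h S \<in> \<Omega>'"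
    and cont: "near_continuous \<Omega> h"
begin

lemma near_image:
  assumes "e > 0"
  shows "\<exists>d>0. \<forall>S\<in>\<Omega>. \<forall>T\<in>\<Omega>. near d S T \<longrightarrow> near e (h S) (h T)"
  using cont assms unfolding near_continuous_def by blast

text \<open>For a small \<open>x\<close>, continuity only says that \<open>h (S - x)\<close> agrees with some
  \<open>h S - y\<close> on a large ball of fixed radius.  Moving from \<open>0\<close> to \<open>x\<close> in tiny steps
  preserves agreement on a ball of any prescribed radius, because rigidity forces the shift to
  follow each step exactly.\<close>

lemma agree_along_segment:
  assumes e: "e > 0" "3 * e < \<kappa>'"
    and d: "\<And>S T. S \<in> \<Omega> \<Longrightarrow> T \<in> \<Omega> \<Longrightarrow> near d S T \<Longrightarrow> near e (h S) (h T)"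
    and S: "S \<in> \<Omega>" and x: "norm x \<le> d" and R: "R \<ge> 2 * e + 1"
  shows "\<exists>y. norm y \<le> e \<and> agree R (translate (- y) (h (translate x S))) (h S)"
proof -
  \<comment> \<open>the images of consecutive points agree on the ball of radius \<open>R\<close> even after a shift by \<open>y'\<close>\<close>
  define e2 where "e2 = min e (1 / (R + e))"
  have e2: "e2 > 0" "e2 \<le> e" "e2 \<le> 1 / (R + e)" using e R by (auto simp: e2_def)
  then have e2R: "R + e \<le> 1 / e2" using e R by (simp add: field_simps)
  obtain d2 where d2: "d2 > 0" "\<And>S T. S \<in> \<Omega> \<Longrightarrow> T \<in> \<Omega> \<Longrightarrow> near d2 S T \<Longrightarrow> near e2 (h S) (h T)"
    using near_image[OF e2(1)] by blast
  obtain N s where N: "x = real N *\<^sub>R s" "norm s \<le> d2"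
    using subdivide_vector[OF d2(1)] by blast
  have "\<exists>y. norm y \<le> e \<and> agree R (translate (- y) (h (translate (real k *\<^sub>R s) S))) (h S)"
    if "k \<le> N" for k
    using that
  proof (induction k)
    case 0
    then show ?case using e by (intro exI[of _ 0]) simp
  next
    case (Suc k)
    define A where "A = translate (real k *\<^sub>R s) S"
    define B where "B = translate (real (Suc k) *\<^sub>R s) S"
    have AB: "A \<in> \<Omega>" "B \<in> \<Omega>" "B = translate s A"
      using X.invariant S by (auto simp: A_def B_def algebra_simps)
    obtain y where y: "norm y \<le> e" "agree R (translate (- y) (h A)) (h S)"
      using Suc unfolding A_def by auto
    have "near d2 B A" unfolding near_def AB(3) using N(2) by auto
    then have "near e2 (h B) (h A)" using d2(2) AB by blast
    then obtain u where u: "norm u \<le> e2" "agree (1 / e2) (h B) (translate u (h A))"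
      unfolding near_def by blast
    have "norm (real (Suc k) *\<^sub>R s) \<le> norm x"
      unfolding N(1) norm_scaleR using Suc.prems by (intro mult_right_mono) auto
    then have "norm (real (Suc k) *\<^sub>R s) \<le> d" using x by linarith
    then have "near d B S" unfolding near_def B_def by (intro exI[of _ "real (Suc k) *\<^sub>R s"]) simp
    then have "near e (h B) (h S)" using d AB S by blast
    then obtain y' where y': "norm y' \<le> e" "agree (1 / e) (h B) (translate y' (h S))"
      unfolding near_def by blast
    have "y' = y + u"
    proof (rule Y.rigid)
      show "h S \<in> \<Omega>'" using into S .
      define q where "q = min (1 / e) 1"
      show "q > 0" using e by (simp add: q_def)
      have "norm (y' - (y + u)) \<le> norm y' + (norm y + norm u)"
        using norm_triangle_ineq4[of y' "y + u"] norm_triangle_ineq[of y u] by linarith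
      then show "norm (y' - (y + u)) < \<kappa>'" using y y' u e2 e by linarith
      have "norm (y + u) \<le> 2 * e" using norm_triangle_ineq[of y u] y u e2 by linarith
      then have "agree 1 (translate (y + u) (translate (- y) (h A))) (translate (y + u) (h S))"
        using R by (intro agree_translate[OF y(2)]) linarith
      then have "agree 1 (translate u (h A)) (translate (y + u) (h S))" by simp
      then have "agree q (translate u (h A)) (translate (y + u) (h S))"
        by (rule agree_mono) (simp add: q_def)
      moreover have "agree q (h B) (translate u (h A))"
      proof (rule agree_mono[OF u(2)])
        have "1 / e \<le> 1 / e2" using e2 by (intro frac_le) auto
        then show "q \<le> 1 / e2" by (simp add: q_def)
      qed
      moreover have "agree q (h B) (translate y' (h S))"
        using y'(2) by (rule agree_mono) (simp add: q_def)
      ultimately show "agree q (translate y' (h S)) (translate (y + u) (h S))"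
        by (simp add: agree_def)
    qed
    have "agree R (translate (- y') (h B)) (translate (- y') (translate u (h A)))"
      using y'(1) e2R by (intro agree_translate[OF u(2)]) simp
    then have "agree R (translate (- y') (h B)) (translate (- y) (h A))"
      by (simp add: \<open>y' = y + u\<close>)
    then have "agree R (translate (- y') (h B)) (h S)" using y(2) agree_trans by blast
    then show ?case using y'(1) unfolding B_def by blast
  qed
  then show ?thesis using N(1) by blast
qed

text \<open>The shifts found for the different radii coincide by rigidity.  A single \<open>y\<close> therefore works
  for all radii, and agreement becomes equality.  In particular a homeomorphism maps orbits to
  orbits.\<close>

lemma small_translation_lift:
  assumes "\<eta> > 0"
  shows "\<exists>\<delta>>0. \<forall>S\<in>\<Omega>. \<forall>x. norm x \<le> \<delta> \<longrightarrow>
    (\<exists>y. norm y \<le> \<eta> \<and> h (translate x S) = translate y (h S))"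
proof -
  define e where "e = min \<eta> (\<kappa>' / 4)"
  have e: "e > 0" "3 * e < \<kappa>'" "e \<le> \<eta>" using assms Y.kappa_pos by (auto simp: e_def)
  obtain d where d: "d > 0" "\<And>S T. S \<in> \<Omega> \<Longrightarrow> T \<in> \<Omega> \<Longrightarrow> near d S T \<Longrightarrow> near e (h S) (h T)"
    using near_image[OF e(1)] by blast
  have "\<exists>y. norm y \<le> \<eta> \<and> h (translate x S) = translate y (h S)" if S: "S \<in> \<Omega>" and x: "norm x \<le> d" for S x
  proof -
    define A where "A = h (translate x S)"
    have A: "A \<in> \<Omega>'" unfolding A_def using into X.invariant S by blast
    have *: "\<exists>y. norm y \<le> e \<and> agree R (translate (- y) A) (h S)" if "R \<ge> 2 * e + 1" for R
      unfolding A_def using agree_along_segment[OF e(1,2) d(2) S x that] by blast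
    obtain y where y: "norm y \<le> e" "agree (2 * e + 1) (translate (- y) A) (h S)"
      using *[of "2 * e + 1"] by blast
    have "translate (- y) A = h S"
    proof (rule eq_if_agree)
      fix r :: real assume "r > 0"
      define R where "R = max r (2 * e + 1)"
      obtain y' where y': "norm y' \<le> e" "agree R (translate (- y') A) (h S)"
        using *[of R] by (auto simp: R_def)
      have "agree (2 * e + 1) (translate (- y') A) (h S)"
        using y'(2) by (rule agree_mono) (simp add: R_def)
      then have "agree (2 * e + 1) (translate (- y) A) (translate (- y') A)"
        using y(2) agree_sym agree_trans by blast
      moreover have "norm (- y - - y') < \<kappa>'"
        using norm_triangle_ineq4[of "- y" "- y'"] y y' e by simp
      ultimately have "- y = - y'" using e(1) by (intro Y.rigid[OF A, of "2 * e + 1"]) auto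
      then show "\<exists>s\<ge>r. agree s (translate (- y) A) (h S)"
        using y'(2) by (intro exI[of _ R]) (simp add: R_def)
    qed (use Y.tile_nonempty Y.invariant A into S in blast)+
    then have "translate y (translate (- y) A) = translate y (h S)" by simp
    then have "A = translate y (h S)" by simp
    then show ?thesis using y(1) e(3) unfolding A_def by (meson order_trans)
  qed
  then show ?thesis using d(1) by blast
qed

text \<open>Iterating the lift of one small step \<open>s\<close> gives the positions \<open>y k\<close> of a discrete path in
  the orbit of \<open>h S\<close> that follows the multiples of \<open>s\<close>.\<close>

lemma path_lift:
  assumes lift: "\<And>S x. S \<in> \<Omega> \<Longrightarrow> norm x \<le> \<delta> \<Longrightarrow>
      \<exists>y. norm y \<le> \<eta> \<and> h (translate x S) = translate y (h S)"
    and S: "S \<in> \<Omega>" and s: "norm s \<le> \<delta>"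
  shows "\<exists>y. y 0 = 0 \<and> (\<forall>k. h (translate (real k *\<^sub>R s) S) = translate (y k) (h S) \<and>
    norm (y (Suc k) - y k) \<le> \<eta> \<and> norm (y k) \<le> real k * \<eta>)"
proof -
  have "\<exists>v. norm v \<le> \<eta> \<and> h (translate s (translate (real k *\<^sub>R s) S)) =
    translate v (h (translate (real k *\<^sub>R s) S))" for k
    using lift X.invariant S s by blast
  then obtain v where v: "\<And>k. norm (v k) \<le> \<eta>"
    "\<And>k. h (translate s (translate (real k *\<^sub>R s) S)) = translate (v k) (h (translate (real k *\<^sub>R s) S))"
    by metis
  define y where "y k = (\<Sum>j<k. v j)" for k
  have "h (translate (real k *\<^sub>R s) S) = translate (y k) (h S)" for k
  proof (induction k)
    case (Suc k)
    have "h (translate (real (Suc k) *\<^sub>R s) S) = h (translate s (translate (real k *\<^sub>R s) S))"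
      by (simp add: algebra_simps)
    also have "\<dots> = translate (v k) (translate (y k) (h S))" by (simp only: v(2) Suc)
    finally show ?case by (simp add: y_def add.commute)
  qed (simp add: y_def)
  moreover have "norm (y k) \<le> real k * \<eta>" for k
    using sum_norm_bound[of "{..<k}" v \<eta>] v(1) by (simp add: y_def)
  moreover have "norm (y (Suc k) - y k) \<le> \<eta>" for k using v(1) by (simp add: y_def)
  moreover have "y 0 = 0" by (simp add: y_def)
  ultimately show ?thesis by blast
qed

text \<open>A translation by \<open>x\<close> is a composite of small steps, whose number grows linearly with \<open>norm x\<close>, and
  each step is lifted to a translation of bounded length.\<close>

lemma translation_lift:
  "\<exists>C>0. \<forall>S\<in>\<Omega>. \<forall>x. \<exists>y. h (translate x S) = translate y (h S) \<and> norm y \<le> C * norm x + C"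
proof -
  obtain \<delta> where \<delta>: "\<delta> > 0" "\<And>S x. S \<in> \<Omega> \<Longrightarrow> norm x \<le> \<delta> \<Longrightarrow>
      \<exists>y. norm y \<le> 1 \<and> h (translate x S) = translate y (h S)"
    using small_translation_lift[of 1] by auto
  define C where "C = max (1 / \<delta>) 1"
  have "\<exists>y. h (translate x S) = translate y (h S) \<and> norm y \<le> C * norm x + C" if S: "S \<in> \<Omega>" for S x
  proof -
    obtain N s where N: "x = real N *\<^sub>R s" "norm s \<le> \<delta>" "real N \<le> norm x / \<delta> + 1"
      using subdivide_vector[OF \<delta>(1)] by blast
    obtain y where y: "h (translate (real N *\<^sub>R s) S) = translate (y N) (h S)" "norm (y N) \<le> real N * 1"
      using path_lift[OF \<delta>(2) S N(2)] by blast
    have "1 / \<delta> * norm x \<le> C * norm x" by (intro mult_right_mono) (auto simp: C_def)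
    moreover have "1 \<le> C" by (simp add: C_def)
    ultimately have "norm (y N) \<le> C * norm x + C" using y(2) N(3) by simp
    then show ?thesis using y(1) N(1) by blast
  qed
  moreover have "C > 0" by (simp add: C_def)
  ultimately show ?thesis by blast
qed

end

section \<open>Transfer of agreement and of repetitivity\<close>

locale tiling_homeo =
  H: tiling_map \<Omega> \<kappa> \<Omega>' \<kappa>' h + G: tiling_map \<Omega>' \<kappa>' \<Omega> \<kappa> g
  for \<Omega> :: "('n::finite, 'l) tiling set" and \<kappa> :: real
    and \<Omega>' :: "('n, 'k) tiling set" and \<kappa>' :: real and h g +
  assumes gh: "\<And>S. S \<in> \<Omega> \<Longrightarrow> g (h S) = S" and hg: "\<And>S. S \<in> \<Omega>' \<Longrightarrow> h (g S) = S"
begin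

text \<open>The heart of the proof: agreement of the images on a ball of radius about \<open>M * r\<close> forces the
  preimages to agree, after one small translation \<open>z\<close>, on a ball of radius \<open>r\<close>.

  To reach a point \<open>w\<close> of that ball, divide the segment from \<open>0\<close> to \<open>w\<close> into small steps and lift it to
  a path \<open>y\<close> with \<open>h (S0 - k s) = h S0 - y k\<close>.  This path stays where \<open>h S\<close> and \<open>h S0\<close> agree, so
  \<open>h S - y k\<close> is near \<open>h S0 - y k\<close>, and applying \<open>g\<close> shows that some translate of \<open>S\<close> agrees with
  \<open>S0 - k s\<close> around the origin.  Consecutive translates are close to each other, so by rigidity they
  differ exactly by \<open>s\<close>; hence the displacement between \<open>S\<close> and \<open>S0\<close> is the same \<open>z\<close> at \<open>w\<close> as at
  \<open>0\<close>.\<close>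

lemma agree_transfer:
  "\<exists>M>0. \<forall>r>0. \<forall>S\<in>\<Omega>. \<forall>S0\<in>\<Omega>. agree (M * r + M) (h S) (h S0) \<longrightarrow>
    (\<exists>z. norm z \<le> 1 \<and> agree r (translate z S) S0)"
proof -
  \<comment> \<open>four errors of size \<open>\<eta>\<close> meet in the comparison of consecutive translates below\<close>
  define \<eta> where "\<eta> = min (1 / 2) (\<kappa> / 5)"
  have \<eta>: "\<eta> > 0" "\<eta> \<le> 1 / 2" "4 * \<eta> < \<kappa>"
    using H.X.kappa_pos by (auto simp: \<eta>_def min_def)
  define K where "K = 1 / \<eta>"
  have "2 \<le> K" using \<eta> by (simp add: K_def field_simps)
  then have K: "K - \<eta> > 0" using \<eta>(2) by linarith
  obtain d where d: "d > 0" "\<And>A B. A \<in> \<Omega>' \<Longrightarrow> B \<in> \<Omega>' \<Longrightarrow> near d A B \<Longrightarrow> near \<eta> (g A) (g B)"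
    using G.near_image[OF \<eta>(1)] by blast
  obtain \<delta>1 where \<delta>1: "\<delta>1 > 0" "\<And>A u. A \<in> \<Omega>' \<Longrightarrow> norm u \<le> \<delta>1 \<Longrightarrow>
      \<exists>v. norm v \<le> \<eta> \<and> g (translate u A) = translate v (g A)"
    using G.small_translation_lift[OF \<eta>(1)] by blast
  obtain \<delta>0 where \<delta>0: "\<delta>0 > 0" "\<And>S x. S \<in> \<Omega> \<Longrightarrow> norm x \<le> \<delta>0 \<Longrightarrow>
      \<exists>y. norm y \<le> \<delta>1 \<and> h (translate x S) = translate y (h S)"
    using H.small_translation_lift[OF \<delta>1(1)] by blast
  define \<delta> where "\<delta> = min \<delta>0 \<eta>"
  have \<delta>: "\<delta> > 0" "\<delta> \<le> \<delta>0" "\<delta> \<le> \<eta>" using \<delta>0 \<eta> by (auto simp: \<delta>_def)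
  define M where "M = max (\<delta>1 / \<delta>) (\<delta>1 + 1 / d)"
  have M: "M > 0" "\<delta>1 / \<delta> \<le> M" "\<delta>1 + 1 / d \<le> M"
    using \<delta>1 \<delta> d by (auto simp: M_def less_max_iff_disj)
  have "\<exists>z. norm z \<le> 1 \<and> agree r (translate z S) S0"
    if r: "r > 0" and S: "S \<in> \<Omega>" and S0: "S0 \<in> \<Omega>" and agr: "agree (M * r + M) (h S) (h S0)" for r S S0
  proof -
    \<comment> \<open>a displacement of at most \<open>M * r + M - 1 / d\<close> keeps the images \<open>d\<close>-near\<close>
    have close: "near \<eta> (g (translate y (h S0))) (g (translate y (h S)))"
      if "norm y + 1 / d \<le> M * r + M" for y
    proof -
      have "agree (1 / d) (translate y (h S)) (translate y (h S0))"
        using that by (intro agree_translate[OF agr]) simp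
      then have "near d (translate y (h S0)) (translate y (h S))"
        unfolding near_def using d(1) by (intro exI[of _ 0]) (auto intro: agree_sym)
      then show ?thesis using d(2) H.Y.invariant H.into S S0 by blast
    qed
    have "norm (0 :: real^'n) + 1 / d \<le> M * r + M" using M r \<delta>1(1) by (simp add: add_increasing)
    then have "near \<eta> S0 S" using close[of 0] gh S S0 by simp
    then obtain z where z: "norm z \<le> \<eta>" "agree K S0 (translate z S)"
      unfolding near_def K_def by blast
    have "agree (K - \<eta>) (translate w (translate z S)) (translate w S0)" if w: "norm w < r" for w
    proof -
      obtain N s where N: "w = real N *\<^sub>R s" "norm s \<le> \<delta>" "real N \<le> norm w / \<delta> + 1"
        using subdivide_vector[OF \<delta>(1)] by blast
      have "norm s \<le> \<delta>0" using N(2) \<delta>(2) by linarith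
      then obtain y where y: "y 0 = 0"
        "\<And>k. h (translate (real k *\<^sub>R s) S0) = translate (y k) (h S0)"
        "\<And>k. norm (y (Suc k) - y k) \<le> \<delta>1" "\<And>k. norm (y k) \<le> real k * \<delta>1"
        using H.path_lift[OF \<delta>0(2) S0] by blast
      have y_le: "norm (y k) + 1 / d \<le> M * r + M" if "k \<le> N" for k
      proof -
        have "real k \<le> r / \<delta> + 1"
          using that N(3) w \<delta>(1) divide_right_mono[of "norm w" r \<delta>] by linarith
        then have "real k * \<delta>1 \<le> (r / \<delta> + 1) * \<delta>1" using \<delta>1(1) by (intro mult_right_mono) auto
        also have "\<dots> = (\<delta>1 / \<delta>) * r + \<delta>1" by (simp add: field_simps)
        also have "\<dots> \<le> M * r + \<delta>1" using M(2) r by (intro add_mono mult_right_mono) auto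
        finally show ?thesis using y(4)[of k] M(3) by linarith
      qed
      have S0k: "g (translate (y k) (h S0)) = translate (real k *\<^sub>R s) S0" for k
        using y(2)[of k] gh[OF H.X.invariant[OF S0, of "real k *\<^sub>R s"]] by simp
      \<comment> \<open>the lifts of the path for \<open>S\<close> and for \<open>S0\<close> keep differing by the same \<open>z\<close>, up to an
        error \<open>e\<close> that rigidity keeps from accumulating\<close>
      have "\<exists>e. norm e \<le> \<eta> \<and> g (translate (y k) (h S)) = translate (z + real k *\<^sub>R s - e) S \<and>
          agree K (translate (z + real k *\<^sub>R s) S) (translate (real k *\<^sub>R s) S0)" if "k \<le> N" for k
        using that
      proof (induction k)
        case 0
        show ?case
          using z gh[OF S] y(1) by (intro exI[of _ z]) (auto intro: agree_sym)
      next
        case (Suc k)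
        let ?w = "real k *\<^sub>R s" and ?w' = "real (Suc k) *\<^sub>R s"
        have w': "?w' = s + ?w" by (simp add: algebra_simps)
        obtain e where e: "norm e \<le> \<eta>" "g (translate (y k) (h S)) = translate (z + ?w - e) S"
          "agree K (translate (z + ?w) S) (translate ?w S0)"
          using Suc by auto
        have yS: "translate (y k) (h S) \<in> \<Omega>'" using H.Y.invariant H.into S by blast
        obtain v where v: "norm v \<le> \<eta>" "g (translate (y (Suc k) - y k) (translate (y k) (h S))) =
            translate v (g (translate (y k) (h S)))"
          using \<delta>1(2)[OF yS y(3)] by blast
        have gS: "g (translate (y (Suc k)) (h S)) = translate (v + (z + ?w - e)) S"
          using v(2) e(2) by simp
        have "near \<eta> (translate ?w' S0) (translate (v + (z + ?w - e)) S)"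
          using close[OF y_le[OF Suc.prems]] by (simp only: S0k gS)
        then obtain e' where e': "norm e' \<le> \<eta>"
          "agree K (translate ?w' S0) (translate (e' + (v + (z + ?w - e))) S)"
          unfolding near_def K_def by auto
        have "agree (K - \<eta>) (translate s (translate (z + ?w) S)) (translate s (translate ?w S0))"
          using N(2) \<delta>(3) by (intro agree_translate[OF e(3)]) simp
        then have "agree (K - \<eta>) (translate (s + (z + ?w)) S) (translate ?w' S0)"
          by (simp only: w' translate_add)
        moreover have "agree (K - \<eta>) (translate ?w' S0) (translate (e' + (v + (z + ?w - e))) S)"
          using e'(2) by (rule agree_mono) (use \<eta> in simp)
        ultimately have "agree (K - \<eta>) (translate (s + (z + ?w)) S) (translate (e' + (v + (z + ?w - e))) S)"
          by (rule agree_trans)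
        moreover have "norm ((s + (z + ?w)) - (e' + (v + (z + ?w - e)))) < \<kappa>"
        proof -
          have "(s + (z + ?w)) - (e' + (v + (z + ?w - e))) = (s - e') + (e - v)" by simp
          then have "norm ((s + (z + ?w)) - (e' + (v + (z + ?w - e)))) \<le> norm (s - e') + norm (e - v)"
            by (simp only: norm_triangle_ineq)
          also have "\<dots> \<le> (norm s + norm e') + (norm e + norm v)"
            using norm_triangle_ineq4[of s e'] norm_triangle_ineq4[of e v] by linarith
          finally show ?thesis using N(2) \<delta>(3) e(1) e'(1) v(1) \<eta>(3) by linarith
        qed
        ultimately have eq: "s + (z + ?w) = e' + (v + (z + ?w - e))"
          using K S by (intro H.X.rigid[of S "K - \<eta>"]) auto
        have "z + ?w' = s + (z + ?w)" unfolding w' by (rule add.left_commute)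
        then have zw: "z + ?w' = e' + (v + (z + ?w - e))" using eq by (rule trans)
        then have "z + ?w' - e' = v + (z + ?w - e)" by (simp only: add_diff_cancel_left')
        then have "g (translate (y (Suc k)) (h S)) = translate (z + ?w' - e') S"
          by (simp only: gS)
        moreover have "agree K (translate (z + ?w') S) (translate ?w' S0)"
          unfolding zw using e'(2) by (rule agree_sym)
        ultimately show ?case using e'(1) by blast
      qed
      then have "agree K (translate (z + w) S) (translate w S0)" using N(1) by blast
      then have "agree K (translate w (translate z S)) (translate w S0)" by (simp add: add.commute)
      then show ?thesis by (rule agree_mono) (use \<eta> in simp)
    qed
    then have "agree r (translate z S) S0" using K by (rule agree_if_locally_agree)
    then show ?thesis using z(1) \<eta>(2) by (intro exI[of _ z]) auto
  qed
  then show ?thesis using M(1) by blast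
qed

end

definition return_radii :: "('n::finite, 'l) tiling set \<Rightarrow> real \<Rightarrow> real set" where
  "return_radii \<Xi> r =
     {R. R > 0 \<and> (\<forall>S\<in>\<Xi>. \<forall>S0\<in>\<Xi>. \<exists>x. norm x < R \<and> agree r (translate x S) S0)}"

lemma repetitivity_eq: "repetitivity \<Xi> r = Inf (return_radii \<Xi> r)"
  by (simp add: repetitivity_def return_radii_def agree_def Bex_def)

lemma bdd_below_return_radii: "bdd_below (return_radii \<Xi> r)"
  unfolding bdd_below_def return_radii_def by (intro exI[of _ 0]) auto

text \<open>A return in \<open>\<Xi>'\<close> of the patch of radius \<open>M * r\<close> around \<open>h S0\<close>, at a point of the orbit of \<open>h S\<close>,
  is pulled back by \<open>g\<close> to a return of the patch of radius \<open>r\<close> around \<open>S0\<close>.  Its distance grows by a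
  linear factor and an additive constant; the constant \<open>K\<close> accounts for moving in and out of \<open>\<Xi>'\<close>.
  The lower bound \<open>l\<close> turns the additive constant into part of the factor.\<close>

lemma (in tiling_homeo) repetitivity_transfer:
  assumes \<Xi>: "\<Xi> \<subseteq> \<Omega>" and \<Xi>': "\<Xi>' \<subseteq> \<Omega>'"
    and hit: "\<And>S. S \<in> \<Omega>' \<Longrightarrow> \<exists>a. norm a \<le> K \<and> translate a S \<in> \<Xi>'" and "K \<ge> 0"
    and fin: "\<And>r. r > 0 \<Longrightarrow> return_radii \<Xi>' r \<noteq> {}"
    and low: "\<forall>\<^sub>F r in at_top. l \<le> repetitivity \<Xi>' r" and "l > 0"
  shows "\<exists>C>0. \<exists>M>0. \<forall>\<^sub>F r in at_top. repetitivity \<Xi> r \<le> C * repetitivity \<Xi>' (M * r)"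
proof -
  obtain M0 where M0: "M0 > 0" "\<And>r S S0. r > 0 \<Longrightarrow> S \<in> \<Omega> \<Longrightarrow> S0 \<in> \<Omega> \<Longrightarrow>
      agree (M0 * r + M0) (h S) (h S0) \<Longrightarrow> \<exists>z. norm z \<le> 1 \<and> agree r (translate z S) S0"
    using agree_transfer by blast
  obtain C0 where C0: "C0 > 0" "\<And>S x. S \<in> \<Omega>' \<Longrightarrow>
      \<exists>y. g (translate x S) = translate y (g S) \<and> norm y \<le> C0 * norm x + C0"
    using G.translation_lift by blast
  define M where "M = 2 * M0 + K"
  have "M > 0" using M0(1) \<open>K \<ge> 0\<close> by (simp add: M_def)
  define E where "E = C0 * (2 * K + 2) + 2"
  have "E > 0" using C0(1) \<open>K \<ge> 0\<close> by (simp add: E_def add_nonneg_pos)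
  have main: "repetitivity \<Xi> r \<le> C0 * repetitivity \<Xi>' (M * r) + E" if "r \<ge> 1" for r
  proof -
    have "M * r > 0" using \<open>M > 0\<close> that by simp
    have "Inf (return_radii \<Xi>' (M * r)) < repetitivity \<Xi>' (M * r) + 1" by (simp add: repetitivity_eq)
    then obtain R where R: "R \<in> return_radii \<Xi>' (M * r)" "R < repetitivity \<Xi>' (M * r) + 1"
      using cInf_lessD fin[OF \<open>M * r > 0\<close>] by metis
    then have "R > 0" by (simp add: return_radii_def)
    define Q where "Q = C0 * (R + 2 * K) + C0 + 2"
    have "\<exists>x. norm x < Q \<and> agree r (translate x S) S0" if S: "S \<in> \<Xi>" and S0: "S0 \<in> \<Xi>" for S S0
    proof -
      have S\<Omega>: "S \<in> \<Omega>" "S0 \<in> \<Omega>" using \<Xi> S S0 by auto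
      obtain a b where a: "norm a \<le> K" "translate a (h S) \<in> \<Xi>'" and b: "norm b \<le> K" "translate b (h S0) \<in> \<Xi>'"
        using hit H.into S\<Omega> by meson
      obtain x where x: "norm x < R" "agree (M * r) (translate x (translate a (h S))) (translate b (h S0))"
        using R(1) a(2) b(2) unfolding return_radii_def by blast
      define y where "y = - b + (x + a)"
      have y: "norm y \<le> R + 2 * K"
        using norm_triangle_ineq[of "- b" "x + a"] norm_triangle_ineq[of x a] a b x by (simp add: y_def)
      obtain p where p: "g (translate y (h S)) = translate p (g (h S))" "norm p \<le> C0 * norm y + C0"
        using C0(2) H.into S\<Omega> by blast
      have hp: "h (translate p S) = translate y (h S)"
        using p(1) gh[OF S\<Omega>(1)] hg[OF H.Y.invariant[OF H.into[OF S\<Omega>(1)]], of y] by simp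
      have "M0 * 1 \<le> M0 * r" "K * 1 \<le> K * r"
        using \<open>r \<ge> 1\<close> M0(1) \<open>K \<ge> 0\<close> by (intro mult_left_mono; simp)+
      then have "(M0 * r + M0) + norm (- b) \<le> M * r"
        using b(1) by (simp add: M_def algebra_simps)
      then have "agree (M0 * r + M0) (translate (- b) (translate x (translate a (h S))))
          (translate (- b) (translate b (h S0)))"
        by (rule agree_translate[OF x(2)])
      then have "agree (M0 * r + M0) (h (translate p S)) (h S0)"
        by (simp add: hp y_def)
      then obtain z where z: "norm z \<le> 1" "agree r (translate z (translate p S)) S0"
        using M0(2)[of r "translate p S" S0] \<open>r \<ge> 1\<close> H.X.invariant S\<Omega> by auto
      have "C0 * norm y \<le> C0 * (R + 2 * K)" using y C0(1) by (intro mult_left_mono) auto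
      then have "norm (z + p) < Q"
        using norm_triangle_ineq[of z p] z(1) p(2) by (simp add: Q_def)
      then show ?thesis using z(2) by auto
    qed
    moreover have "Q > 0" using C0(1) \<open>R > 0\<close> \<open>K \<ge> 0\<close> by (simp add: Q_def add_nonneg_pos)
    ultimately have "Q \<in> return_radii \<Xi> r" by (simp add: return_radii_def)
    then have "repetitivity \<Xi> r \<le> Q"
      unfolding repetitivity_eq by (rule cInf_lower) (rule bdd_below_return_radii)
    moreover have "C0 * R \<le> C0 * (repetitivity \<Xi>' (M * r) + 1)"
      using R(2) C0(1) by (intro mult_left_mono) auto
    ultimately show ?thesis by (simp add: Q_def E_def algebra_simps)
  qed
  have "filterlim (\<lambda>r. M * r) at_top at_top"
    using \<open>M > 0\<close> filterlim_tendsto_pos_mult_at_top[OF tendsto_const _ filterlim_ident] by blast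
  then have "\<forall>\<^sub>F r in at_top. l \<le> repetitivity \<Xi>' (M * r)"
    using low unfolding filterlim_iff by blast
  then have "\<forall>\<^sub>F r in at_top. repetitivity \<Xi> r \<le> (C0 + E / l) * repetitivity \<Xi>' (M * r)"
    using eventually_ge_at_top[of 1]
  proof eventually_elim
    case (elim r)
    have "E = (E / l) * l" using \<open>l > 0\<close> by simp
    also have "\<dots> \<le> (E / l) * repetitivity \<Xi>' (M * r)"
      using elim(1) \<open>E > 0\<close> \<open>l > 0\<close> by (intro mult_left_mono) auto
    finally show ?case using main[OF elim(2)] by (simp add: distrib_right)
  qed
  moreover have "C0 + E / l > 0" using C0(1) \<open>E > 0\<close> \<open>l > 0\<close> by (simp add: add_pos_pos)
  ultimately show ?thesis using \<open>M > 0\<close> by blast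
qed

section \<open>A canonical transversal of the hull\<close>

context flc_hull
begin

text \<open>The pointing rule marks the occurrences of the patch of radius one that \<open>T\<close> has at the
  origin.  Rigidity makes it uniformly discrete and uniform repetitivity makes it relatively
  dense.\<close>

definition occurrences :: "('n, 'l) tiling \<Rightarrow> (real^'n) set" where
  "occurrences S = {x. agree 1 (translate x S) T}"

definition transversal :: "('n, 'l) tiling set" where
  "transversal = {S \<in> \<Omega>. agree 1 S T}"

lemma occurrences_hit: "\<exists>K\<ge>0. \<forall>S\<in>\<Omega>. \<exists>a. norm a \<le> K \<and> translate a S \<in> transversal"
proof -
  obtain R where R: "R > 0" "\<And>S. S \<in> \<Omega> \<Longrightarrow> \<exists>y. norm y < R \<and> agree 1 (translate y S) T"
    using uniformly_repetitive[of 1] orbit_in_hull[of 0] by auto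
  have "\<exists>a. norm a \<le> R \<and> translate a S \<in> transversal" if S: "S \<in> \<Omega>" for S
  proof -
    obtain y where "norm y < R" "agree 1 (translate y S) T" using R(2)[OF S] by blast
    then show ?thesis
      using translate_hull[OF S] by (intro exI[of _ y]) (simp add: transversal_def)
  qed
  then show ?thesis using R(1) less_imp_le by blast
qed

lemma canonical_transversal_transversal: "canonical_transversal \<Omega> transversal"
proof -
  have "delaunay (occurrences S)" if S: "S \<in> \<Omega>" for S
  proof -
    have "x = y" if "x \<in> occurrences S" "y \<in> occurrences S" "dist x y < \<rho>" for x y
    proof (rule rigid_diff[OF hull_tilings[OF S], of 1])
      show "agree 1 (translate x S) (translate y S)"
        using that(1,2) unfolding occurrences_def agree_def by simp
    qed (use that(3) in \<open>simp_all add: dist_norm\<close>)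
    then have "uniform_discrete (occurrences S)"
      unfolding uniform_discrete_def using rho_pos by blast
    moreover obtain K where K: "K \<ge> 0" "\<And>S. S \<in> \<Omega> \<Longrightarrow> \<exists>a. norm a \<le> K \<and> translate a S \<in> transversal"
      using occurrences_hit by blast
    have "occurrences S \<inter> ball x (K + 1) \<noteq> {}" for x
    proof -
      obtain a where "norm a \<le> K" "translate a (translate x S) \<in> transversal"
        using K(2) translate_hull[OF S] by blast
      then have "a + x \<in> occurrences S \<inter> ball x (K + 1)"
        by (simp add: occurrences_def transversal_def dist_norm)
      then show ?thesis by blast
    qed
    ultimately show ?thesis unfolding delaunay_def using K(1) by (metis add_nonneg_pos zero_less_one)
  qed
  moreover have "occurrences (translate x S) = (\<lambda>y. y - x) ` occurrences S" for x S
  proof (intro subset_antisym subsetI)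
    fix y assume "y \<in> occurrences (translate x S)"
    then have "y + x \<in> occurrences S" by (simp add: occurrences_def)
    then show "y \<in> (\<lambda>y. y - x) ` occurrences S" by (rule rev_image_eqI) simp
  qed (auto simp: occurrences_def)
  moreover have "occurrences S1 \<inter> ball 0 1 = occurrences S2 \<inter> ball 0 1"
    if "patch S1 0 2 = patch S2 0 2" for S1 S2
  proof -
    have "agree 1 (translate x S1) (translate x S2)" if "norm x < 1" for x
      by (rule agree_translate[of 2]) (use that \<open>patch S1 0 2 = patch S2 0 2\<close> in \<open>simp_all add: agree_def\<close>)
    then show ?thesis unfolding occurrences_def by (auto simp: agree_def)
  qed
  ultimately have "local_pointing_rule \<Omega> occurrences"
    unfolding local_pointing_rule_def using zero_less_one zero_less_numeral by metis
  moreover have "transversal = {S \<in> \<Omega>. 0 \<in> occurrences S}"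
    by (simp add: transversal_def occurrences_def)
  ultimately show ?thesis unfolding canonical_transversal_def by blast
qed

lemma return_radii_transversal: "r > 0 \<Longrightarrow> return_radii transversal r \<noteq> {}"
  using uniformly_repetitive[of r] unfolding return_radii_def transversal_def by blast

text \<open>Return vectors to the transversal are either zero or at least \<open>\<rho>\<close> long by rigidity.  Since
  \<open>T\<close> is aperiodic, some translate \<open>T - w\<close> in the transversal differs from \<open>T\<close>; for large \<open>r\<close> it takes a
  nonzero vector to move from \<open>T\<close> to it.\<close>

lemma repetitivity_transversal_ge: "\<forall>\<^sub>F r in at_top. \<rho> \<le> repetitivity transversal r"
proof -
  obtain R where R: "R > 0" "\<And>S. S \<in> \<Omega> \<Longrightarrow> \<exists>y. norm y < R \<and> agree 1 (translate y S) T"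
    using uniformly_repetitive[of 1] orbit_in_hull[of 0] by auto
  \<comment> \<open>looking for a return to \<open>T\<close> within \<open>R\<close> of a point at distance \<open>R\<close> excludes the origin\<close>
  obtain a :: "real^'n" where a: "norm a = R" using R(1) vector_choose_size[of R] by auto
  obtain y where y: "norm y < R" "agree 1 (translate y (translate a T)) T"
    using R(2) orbit_in_hull by blast
  define w where "w = y + a"
  have w: "w \<noteq> 0" "agree 1 (translate w T) T"
    using y a by (auto simp: w_def add_eq_0_iff)
  have "translate w T \<noteq> T" using aper w(1) by (simp add: aperiodic_def)
  then have "\<not> (\<forall>r>0. \<exists>s\<ge>r. agree s T (translate w T))"
    using eq_if_agree[of T "translate w T"] tile_nonempty tiling_tile T translate_tilings[OF T] by metis
  then obtain r1 where r1: "\<And>s. s \<ge> r1 \<Longrightarrow> \<not> agree s T (translate w T)" by blast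
  have "\<rho> \<le> repetitivity transversal r" if r: "r \<ge> max 1 r1" for r
    unfolding repetitivity_eq
  proof (rule cInf_greatest)
    show "return_radii transversal r \<noteq> {}" using r by (intro return_radii_transversal) simp
    fix Q assume Q: "Q \<in> return_radii transversal r"
    show "\<rho> \<le> Q"
    proof (rule ccontr)
      assume "\<not> \<rho> \<le> Q"
      have "T \<in> transversal" "translate w T \<in> transversal"
        using w(2) orbit_in_hull[of 0] orbit_in_hull[of w] by (auto simp: transversal_def)
      then obtain x where x: "norm x < Q" "agree r (translate x T) (translate w T)"
        using Q unfolding return_radii_def by blast
      have "agree 1 (translate x T) (translate w T)" using x(2) by (rule agree_mono) (use r in simp)
      then have "agree 1 (translate x T) (translate 0 T)" using w(2) by (simp add: agree_def)
      then have "x = 0"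
        using x(1) \<open>\<not> \<rho> \<le> Q\<close> by (intro rigid_diff[OF T, of 1]) auto
      then show False using x(2) r1[of r] r by simp
    qed
  qed
  then show ?thesis unfolding eventually_at_top_linorder by blast
qed

end

lemma repetitivity_le_if_homeo:
  assumes X: "flc_hull \<P> \<rho> D T \<Omega>" and Y: "flc_hull \<P>' \<rho>' D' T' \<Omega>'"
    and cont: "near_continuous \<Omega> h" "near_continuous \<Omega>' g"
    and into: "\<And>S. S \<in> \<Omega> \<Longrightarrow> h S \<in> \<Omega>'" "\<And>S. S \<in> \<Omega>' \<Longrightarrow> g S \<in> \<Omega>"
    and inv: "\<And>S. S \<in> \<Omega> \<Longrightarrow> g (h S) = S" "\<And>S. S \<in> \<Omega>' \<Longrightarrow> h (g S) = S"
  shows "\<exists>C>0. \<exists>M>0. \<forall>\<^sub>F r in at_top. repetitivity (flc_hull.transversal T \<Omega>) r \<le>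
    C * repetitivity (flc_hull.transversal T' \<Omega>') (M * r)"
proof -
  interpret X: flc_hull \<P> \<rho> D T \<Omega> by (rule X)
  interpret Y: flc_hull \<P>' \<rho>' D' T' \<Omega>' by (rule Y)
  interpret XS: tiling_system \<Omega> \<rho> by (rule flc_hull_tiling_system[OF X])
  interpret YS: tiling_system \<Omega>' \<rho>' by (rule flc_hull_tiling_system[OF Y])
  interpret tiling_homeo \<Omega> \<rho> \<Omega>' \<rho>' h g
    by unfold_locales (use cont into inv in blast)+
  obtain K where "K \<ge> 0" "\<And>S. S \<in> \<Omega>' \<Longrightarrow> \<exists>a. norm a \<le> K \<and> translate a S \<in> Y.transversal"
    using Y.occurrences_hit by blast
  then show ?thesis
    using Y.return_radii_transversal Y.repetitivity_transversal_ge Y.rho_pos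
    by (intro repetitivity_transfer) (auto simp: X.transversal_def Y.transversal_def)
qed

lemma aperiodic_repetitive_FLC_space_flc_hull:
  assumes "aperiodic_repetitive_FLC_space \<P> \<Omega>"
  shows "\<exists>\<rho> D T. flc_hull \<P> \<rho> D T \<Omega>"
proof -
  obtain \<rho> D where "fat_tiles \<P> \<rho> D"
    using finite_prototiles_fat assms unfolding aperiodic_repetitive_FLC_space_def by blast
  moreover obtain T where "T \<in> tilings \<P>" "aperiodic T" "repetitive T" "finite_local_complexity T"
    "\<Omega> = tiling_hull \<P> T"
    using assms unfolding aperiodic_repetitive_FLC_space_def by blast
  ultimately show ?thesis
    unfolding flc_hull_def flc_hull_axioms_def by blast
qed

theorem theorem3p5:
  fixes \<P> :: "('n::finite, 'l) tile set set" and \<Omega> :: "('n, 'l) tiling set"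
    and \<P>' :: "('n, 'k) tile set set" and \<Omega>' :: "('n, 'k) tiling set"
    and h :: "('n, 'l) tiling \<Rightarrow> ('n, 'k) tiling"
  assumes "aperiodic_repetitive_FLC_space \<P> \<Omega>"
    and "aperiodic_repetitive_FLC_space \<P>' \<Omega>'"
    and "homeomorphic_map (subtopology (tilings_topology \<P>) \<Omega>)
           (subtopology (tilings_topology \<P>') \<Omega>') h"
  shows "\<exists>\<Xi> \<Xi>'. canonical_transversal \<Omega> \<Xi> \<and> canonical_transversal \<Omega>' \<Xi>' \<and>
    (\<exists>c C m M :: real. c > 0 \<and> C > 0 \<and> m > 0 \<and> M > 0 \<and>
      (\<forall>\<^sub>F r in at_top. c * repetitivity \<Xi>' (m * r) \<le> repetitivity \<Xi> r \<and>
        repetitivity \<Xi> r \<le> C * repetitivity \<Xi>' (M * r)))"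
proof -
  obtain \<rho> D T where X: "flc_hull \<P> \<rho> D T \<Omega>"
    using aperiodic_repetitive_FLC_space_flc_hull[OF assms(1)] by blast
  obtain \<rho>' D' T' where Y: "flc_hull \<P>' \<rho>' D' T' \<Omega>'"
    using aperiodic_repetitive_FLC_space_flc_hull[OF assms(2)] by blast
  interpret X: flc_hull \<P> \<rho> D T \<Omega> by (rule X)
  interpret Y: flc_hull \<P>' \<rho>' D' T' \<Omega>' by (rule Y)
  have sub: "\<Omega> \<subseteq> tilings \<P>" "\<Omega>' \<subseteq> tilings \<P>'" using X.hull_tilings Y.hull_tilings by blast+
  have top: "topspace (subtopology (tilings_topology \<P>) \<Omega>) = \<Omega>"
    "topspace (subtopology (tilings_topology \<P>') \<Omega>') = \<Omega>'"
    using sub unfolding tilings_topology_def by (simp_all add: inf.absorb2)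
  obtain g where "homeomorphic_maps (subtopology (tilings_topology \<P>) \<Omega>)
      (subtopology (tilings_topology \<P>') \<Omega>') h g"
    using assms(3) homeomorphic_map_maps by blast
  then have hg: "continuous_map (subtopology (tilings_topology \<P>) \<Omega>) (subtopology (tilings_topology \<P>') \<Omega>') h"
    "continuous_map (subtopology (tilings_topology \<P>') \<Omega>') (subtopology (tilings_topology \<P>) \<Omega>) g"
    "\<And>S. S \<in> \<Omega> \<Longrightarrow> g (h S) = S" "\<And>S. S \<in> \<Omega>' \<Longrightarrow> h (g S) = S"
    unfolding homeomorphic_maps_def top by blast+
  have into: "\<And>S. S \<in> \<Omega> \<Longrightarrow> h S \<in> \<Omega>'" "\<And>S. S \<in> \<Omega>' \<Longrightarrow> g S \<in> \<Omega>"
    using continuous_map_image_subset_topspace[OF hg(1)] continuous_map_image_subset_topspace[OF hg(2)]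
    unfolding top by blast+
  have nc: "near_continuous \<Omega> h" "near_continuous \<Omega>' g"
    using near_continuous_if_continuous_map[OF X Y.fat_tiles_axioms sub(2) hg(1)]
      near_continuous_if_continuous_map[OF Y X.fat_tiles_axioms sub(1) hg(2)] .
  obtain C M where CM: "C > 0" "M > 0"
    "\<forall>\<^sub>F r in at_top. repetitivity X.transversal r \<le> C * repetitivity Y.transversal (M * r)"
    using repetitivity_le_if_homeo[OF X Y nc into hg(3,4)] by blast
  obtain C' M' where CM': "C' > 0" "M' > 0"
    "\<forall>\<^sub>F r in at_top. repetitivity Y.transversal r \<le> C' * repetitivity X.transversal (M' * r)"
    using repetitivity_le_if_homeo[OF Y X nc(2,1) into(2,1) hg(4,3)] by blast
  have "filterlim (\<lambda>r. (1 / M') * r) at_top at_top"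
    using CM'(2) filterlim_tendsto_pos_mult_at_top[OF tendsto_const _ filterlim_ident, of "1 / M'"]
    by simp
  then have "\<forall>\<^sub>F r in at_top. repetitivity Y.transversal ((1 / M') * r) \<le>
      C' * repetitivity X.transversal (M' * ((1 / M') * r))"
    using CM'(3) unfolding filterlim_iff by blast
  then have "\<forall>\<^sub>F r in at_top. (1 / C') * repetitivity Y.transversal ((1 / M') * r) \<le>
      repetitivity X.transversal r"
    by eventually_elim (use CM'(1,2) in \<open>simp add: field_simps\<close>)
  then have "\<forall>\<^sub>F r in at_top. (1 / C') * repetitivity Y.transversal ((1 / M') * r) \<le>
      repetitivity X.transversal r \<and>
      repetitivity X.transversal r \<le> C * repetitivity Y.transversal (M * r)"
    using CM(3) by (rule eventually_conj)
  moreover have "1 / C' > 0" "1 / M' > 0" using CM' by simp_all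
  ultimately show ?thesis
    using X.canonical_transversal_transversal Y.canonical_transversal_transversal CM(1,2) by blast
qed

end
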